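(* Let $X$ be a Euclidean space, let $\bar x \in X$, and let $f : X \to \mathbf{R}$ be a locally Lipschitz function. Suppose that $f$ grows robustly at $\bar x$, that is, there is a set $M \subset X$ containing $\bar x$, which is a $C^2$-smooth manifold around $\bar x$, such that $f$ grows robustly relative to $M$ at $\bar x$. Then the Goldstein modulus of $f$ grows linearly at $\bar x$: there exists a constant $\alpha > 0$ such that $\Gamma f(x) \ge \alpha |x - \bar x|$ for all $x \in X$ near $\bar x$.
   Context: $X$ is a finite-dimensional Euclidean space with inner product $\langle\cdot,\cdot\rangle$, norm $|\cdot|$ and closed unit ball $B$. For a locally Lipschitz $f : X \to \mathbf{R}$, the Clarke subdifferential $\partial f(x)$ is the closed convex hull of all limits $\lim_r \nabla f(x_r)$ arising from sequences $x_r \to x$ of points of differentiability. For $\epsilon \ge 0$, the Goldstein subdifferential is $\partial_\epsilon f(x) = \mathrm{conv}\big(\bigcup_{y \in x + \epsilon B} \partial f(y)\big)$ (nonempty, compact, convex); the Goldstein subgradient $g_\epsilon(x)$ is its shortest vector. The Goldstein modulus is $\Gamma f(x) = \inf\{\epsilon \ge 0 : |g_\epsilon(x)| \le \epsilon\}$. The function $f$ is subdifferentially regular at $x$ when $\lim_{t \downarrow 0} \frac1t (f(x+ty)-f(x)) = \max_{v \in \partial f(x)} \langle v,y\rangle$ for all $y \in X$. Let $M \subset X$ be a set that is a $C^2$-smooth manifold around $\bar x \in M$; for $x$ near $\bar x$, $P_M(x)$ denotes the unique nearest point to $x$ in $M$, and $d_M(x)$ the distance from $x$ to $M$. A locally Lipschitz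 $f$ grows robustly relative to $M$ at $\bar x$ when all the following hold: (1) (quadratic growth) there is $\delta > 0$ with $f(x) - f(\bar x) \ge \frac{\delta}{2}|x - \bar x|^2$ for all $x$ near $\bar x$; (2) $f$ is subdifferentially regular at every point of $M$; (3) the restriction $f_M : M \to \mathbf{R}$ of $f$ to $M$ is $C^2$-smooth; (4) ($\partial f$ is upper Lipschitz relative to $M$ at $\bar x$) there is $K > 0$ such that all $x,y$ near $\bar x$ with $x \in M$ satisfy $\partial f(y) \subset \partial f(x) + K|x-y|B$; (5) (aiming condition) there is $\mu > 0$ such that all $x \in X$ near $\bar x$ and all $v \in \partial f(x)$ satisfy $\langle v, x - P_M(x)\rangle \ge \mu\, d_M(x)$. *)

theory Defs
  imports "HOL-Analysis.Analysis"
begin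

definition locally_lipschitz :: "('a::metric_space \<Rightarrow> 'b::metric_space) \<Rightarrow> bool" where
  "locally_lipschitz f \<longleftrightarrow> (\<forall>x. \<exists>r>0. \<exists>L. L-lipschitz_on (ball x r) f)"

definition clarke_subdifferential :: "('a::euclidean_space \<Rightarrow> real) \<Rightarrow> 'a \<Rightarrow> 'a set" where
  "clarke_subdifferential f x =
     closure (convex hull
       {v. \<exists>xs g. xs \<longlonglongrightarrow> x \<and> (\<forall>r::nat. GDERIV f (xs r) :> g r) \<and> g \<longlonglongrightarrow> v})"

definition goldstein_subdifferential ::
    "real \<Rightarrow> ('a::euclidean_space \<Rightarrow> real) \<Rightarrow> 'a \<Rightarrow> 'a set" where
  "goldstein_subdifferential \<epsilon> f x =
     convex hull (\<Union>y\<in>cball x \<epsilon>. clarke_subdifferential f y)"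

definition goldstein_subgradient ::
    "real \<Rightarrow> ('a::euclidean_space \<Rightarrow> real) \<Rightarrow> 'a \<Rightarrow> 'a" where
  "goldstein_subgradient \<epsilon> f x = arg_min_on norm (goldstein_subdifferential \<epsilon> f x)"

definition goldstein_modulus :: "('a::euclidean_space \<Rightarrow> real) \<Rightarrow> 'a \<Rightarrow> real" where
  "goldstein_modulus f x = Inf {\<epsilon>. 0 \<le> \<epsilon> \<and> norm (goldstein_subgradient \<epsilon> f x) \<le> \<epsilon>}"

(* For locally Lipschitz f the Clarke subdifferential is nonempty and compact, so the
   supremum below is the maximum. *)
definition subdifferentially_regular ::
    "('a::euclidean_space \<Rightarrow> real) \<Rightarrow> 'a \<Rightarrow> bool" where
  "subdifferentially_regular f x \<longleftrightarrow>
     (\<forall>y. ((\<lambda>t. (f (x + t *\<^sub>R y) - f x) / t)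
        \<longlongrightarrow> (SUP v\<in>clarke_subdifferential f x. v \<bullet> y)) (at_right 0))"

(* Only meant for open S; f' and f'' are the first two Frechet derivatives of f on S. *)
definition C2_on ::
    "'a::euclidean_space set \<Rightarrow> ('a \<Rightarrow> 'b::euclidean_space) \<Rightarrow> bool" where
  "C2_on S f \<longleftrightarrow>
     (\<exists>(f' :: 'a \<Rightarrow> 'a \<Rightarrow>\<^sub>L 'b) (f'' :: 'a \<Rightarrow> 'a \<Rightarrow>\<^sub>L ('a \<Rightarrow>\<^sub>L 'b)).
        (\<forall>x\<in>S. (f has_derivative blinfun_apply (f' x)) (at x)) \<and>
        (\<forall>x\<in>S. (f' has_derivative blinfun_apply (f'' x)) (at x)) \<and>
        continuous_on S f'')"

(* Embedded submanifold near xbar: a C2 diffeomorphism between open sets flattens M onto a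
   linear subspace L. Any dimension of L is allowed, from 0 to that of the whole space. *)
definition C2_manifold_around :: "'a::euclidean_space set \<Rightarrow> 'a \<Rightarrow> bool" where
  "C2_manifold_around M xbar \<longleftrightarrow>
     xbar \<in> M \<and>
     (\<exists>(U :: 'a set) (V :: 'a set) \<phi> \<psi> (L :: 'a set).
        open U \<and> open V \<and> xbar \<in> U \<and> homeomorphism U V \<phi> \<psi> \<and>
        C2_on U \<phi> \<and> C2_on V \<psi> \<and> subspace L \<and> \<phi> ` (M \<inter> U) = L \<inter> V)"

(* Smoothness of the restriction of f to M: locally, it extends to a C2 function on an open
   subset of the ambient space. *)
definition C2_restriction :: "'a::euclidean_space set \<Rightarrow> ('a \<Rightarrow> real) \<Rightarrow> bool" where
  "C2_restriction M f \<longleftrightarrow>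
     (\<forall>x\<in>M. \<exists>W g. open W \<and> x \<in> W \<and> C2_on W g \<and> (\<forall>z\<in>M \<inter> W. f z = g z))"

(* Around a point where M is a C2 manifold, the nearest point in M exists and is unique, so
   closest_point is the projection P_M there. *)
definition grows_robustly_relative ::
    "('a::euclidean_space \<Rightarrow> real) \<Rightarrow> 'a set \<Rightarrow> 'a \<Rightarrow> bool" where
  "grows_robustly_relative f M xbar \<longleftrightarrow>
     (\<exists>\<delta>>0. \<forall>\<^sub>F x in nhds xbar. f x - f xbar \<ge> \<delta> / 2 * (norm (x - xbar))\<^sup>2) \<and>
     (\<forall>x\<in>M. subdifferentially_regular f x) \<and>
     C2_restriction M f \<and>
     (\<exists>K>0. \<forall>\<^sub>F (x, y) in nhds xbar \<times>\<^sub>F nhds xbar. x \<in> M \<longrightarrow>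
        clarke_subdifferential f y \<subseteq>
          {u + w | u w. u \<in> clarke_subdifferential f x \<and> w \<in> cball 0 (K * norm (x - y))}) \<and>
     (\<exists>\<mu>>0. \<forall>\<^sub>F x in nhds xbar. \<forall>v\<in>clarke_subdifferential f x.
        v \<bullet> (x - closest_point M x) \<ge> \<mu> * infdist x M)"

definition grows_robustly_at :: "('a::euclidean_space \<Rightarrow> real) \<Rightarrow> 'a \<Rightarrow> bool" where
  "grows_robustly_at f xbar \<longleftrightarrow>
     (\<exists>M. xbar \<in> M \<and> C2_manifold_around M xbar \<and> grows_robustly_relative f M xbar)"

end

theory Submission
  imports Defs
begin

text \<open>Every point near \<open>xbar\<close> has the Clarke subdifferential nonempty by Rademacher's theorem, and the
  Goldstein subdifferential is the convex hull of the limiting gradients over a ball, hence compact;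
  so it suffices to bound all its elements below by \<open>\<alpha> r\<close>, where \<open>r = |x - xbar|\<close> and the radius of
  the ball is below \<open>\<alpha> r\<close>.

  If \<open>x\<close> is within \<open>c r\<close> of its projection \<open>p\<close> onto \<open>M\<close>, the upper Lipschitz condition reduces the
  claim to subgradients \<open>v\<close> at \<open>p\<close>. In a chart, regularity gives \<open>\<langle>v, t\<rangle> = Df(p) t\<close> for tangent
  vectors \<open>t\<close>, and quadratic growth makes the derivative of \<open>f\<close> along \<open>M\<close> grow linearly.

  Otherwise let \<open>N\<close> be the projection onto the normal space of \<open>M\<close> at \<open>xbar\<close>. Since
  \<open>y - P y = N (y - xbar) + o(|y - xbar|)\<close>, the aiming condition at all points \<open>y\<close> of the ball yields a
  lower bound on the inner product with the single vector \<open>N (x - xbar)\<close>, which passes to the convex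
  hull.\<close>

section \<open>Rademacher's theorem\<close>

text \<open>The obstacle is the convex hull: a bound for the subgradients at each point
  \<open>y\<close> of the ball survives the hull only if it is the same convex condition for all
  \<open>y\<close>. Near \<open>M\<close> the common condition is membership in the Clarke
  subdifferential at the single point \<open>p\<close>, enlarged by a ball. Away from
  \<open>M\<close> the aiming vectors \<open>y - P y\<close> change with \<open>y\<close>; replacing
  all of them by one vector costs the Lipschitz constant of \<open>f\<close> times a small multiple
  of \<open>r\<close>, while aiming supplies \<open>\<mu>\<close> times a distance of order
  \<open>r\<close>. The cut \<open>c\<close> between the cases is fixed before
  \<open>\<alpha>\<close> and \<open>\<eta>\<close>, which are then small relative to it. Tangency
  of \<open>M\<close> to first order controls the projection; second derivatives enter only near
  \<open>M\<close>, where the derivative of \<open>f\<close> along \<open>M\<close> has to grow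
  linearly.

  The operators \<open>arg_min_on\<close>, \<open>closest_point\<close> and \<open>Inf\<close> carry
  information only once a minimizer, a nearest point or an admissible radius is known to exist. This
  is the origin of the nonemptiness and compactness results and of the local compactness argument
  for \<open>M\<close>.\<close>

text \<open>The density comes from the Radon-Nikodym theorem, applied to the Stieltjes measure of an
  increasing perturbation of \<open>f\<close>. That measure is absolutely continuous because a
  Lipschitz map sends null sets to null sets.\<close>

lemma lipschitz_real_density:
  fixes f :: "real \<Rightarrow> real"
  assumes lip: "L-lipschitz_on UNIV f"
  obtains k :: "real \<Rightarrow> real" where "\<And>a b. a \<le> b \<Longrightarrow> (k has_integral (f b - f a)) {a..b}"
proof -
  have L0: "L \<ge> 0" using lip lipschitz_on_nonneg by blast
  have fl: "\<bar>f x - f y\<bar> \<le> L * \<bar>x - y\<bar>" for x y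
    using lipschitz_onD[OF lip, of x y] by (simp add: dist_real_def)
  \<comment> \<open>The slope \<open>L + 1\<close> outweighs any decrease of \<open>f\<close> and
    leaves slope at least 1, so \<open>F\<close> is an increasing bijection of the line.\<close>
  define F where "F x = f x + (L + 1) * x" for x
  have Fexp: "y - x \<le> F y - F x" if "x \<le> y" for x y
    using fl[of x y] that unfolding F_def by (auto simp: algebra_simps abs_if split: if_splits)
  have Flip: "\<bar>F y - F x\<bar> \<le> (2 * L + 1) * \<bar>y - x\<bar>" for x y
  proof -
    have "F y - F x = (f y - f x) + (L + 1) * (y - x)" by (simp add: F_def algebra_simps)
    then have "\<bar>F y - F x\<bar> \<le> \<bar>f y - f x\<bar> + (L + 1) * \<bar>y - x\<bar>"
      using L0 by (metis abs_mult abs_of_nonneg abs_triangle_ineq add_nonneg_nonneg zero_le_one)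
    then show ?thesis using fl[of y x] by (simp add: algebra_simps)
  qed
  have Fcont: "continuous_on S F" for S
    using lip unfolding F_def
    by (intro continuous_intros continuous_on_subset[OF lipschitz_on_continuous_on[OF lip]]) auto
  have Fmono: "strict_mono F"
    using Fexp by (intro strict_monoI) (metis diff_gt_0_iff_gt less_eq_real_def order_less_le_trans)
  have inj: "inj F" using Fmono strict_mono_imp_inj_on by blast
  have surj: "surj F"
  proof -
    have "\<exists>x. F x = y" for y
    proof -
      define b where "b = \<bar>y - F 0\<bar>"
      have "F (-b) \<le> y" "y \<le> F b"
        using Fexp[of "-b" 0] Fexp[of 0 b] unfolding b_def by auto
      then show ?thesis using IVT'[of F "-b" y b] Fcont b_def by force
    qed
    then show ?thesis by (metis surjI surj_def)
  qed
  define G where "G = inv F"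
  have FG: "F (G y) = y" for y using surj by (simp add: G_def surj_f_inv_f)
  have GF: "G (F x) = x" for x using inj by (simp add: G_def)
  have leF: "F x \<le> F y \<longleftrightarrow> x \<le> y" for x y using Fmono by (simp add: strict_mono_less_eq)
  have Gvim: "G -` A = F ` A" for A
    using FG GF by (metis bij_image_Collect_eq bij_vimage_eq_inv_image G_def inj surj bij_betw_imp_inj_on bij_def inv_inv_eq bij_imp_bij_inv)
  have Gmono: "mono G" by (intro monoI) (metis FG leF)
  have Gmeas[measurable]: "G \<in> borel_measurable borel"
    by (rule borel_measurable_mono[OF Gmono])
  \<comment> \<open>As \<open>G\<close> inverts \<open>F\<close>, its preimage of
    \<open>{a..b}\<close> is \<open>{F a..F b}\<close>: the image measure is the Stieltjes measure
    of \<open>F\<close>.\<close>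
  define \<mu> where "\<mu> = distr lborel borel G"
  have mu_Icc: "emeasure \<mu> {a..b} = ennreal (F b - F a)" if "a \<le> b" for a b
  proof -
    have "G -` {a..b} = {F a..F b}"
      using FG GF leF by (auto) (metis FG leF)+
    then show ?thesis using leF that by (simp add: \<mu>_def emeasure_distr)
  qed
  have ac: "absolutely_continuous lborel \<mu>"
    unfolding absolutely_continuous_def
  proof
    fix A :: "real set" assume A: "A \<in> null_sets lborel"
    then have Ab: "A \<in> sets borel" by auto
    have "negligible A"
      using A null_sets_completionI unfolding negligible_iff_null_sets by blast
    then have "negligible (F ` A)"
    proof (rule negligible_locally_Lipschitz_image[OF order_refl])
      fix x assume "x \<in> A"
      show "\<exists>T B. open T \<and> x \<in> T \<and> (\<forall>y\<in>A \<inter> T. norm (F y - F x) \<le> B * norm (y - x))"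
        using Flip by (intro exI[of _ UNIV] exI[of _ "2*L+1"]) auto
    qed
    then have "negligible (G -` A)" by (simp add: Gvim)
    moreover have "G -` A \<in> sets borel" using measurable_sets[OF Gmeas Ab] by simp
    ultimately have "emeasure lborel (G -` A) = 0"
      by (simp add: negligible_iff_null_sets null_sets_completion_iff null_setsD1)
    then show "A \<in> null_sets \<mu>"
      using Ab by (intro null_setsI) (auto simp: \<mu>_def emeasure_distr)
  qed
  obtain h where h[measurable]: "h \<in> borel_measurable lborel" and dens: "density lborel h = \<mu>"
    using sigma_finite_measure.Radon_Nikodym[OF sigma_finite_lborel ac] by (auto simp: \<mu>_def)
  have nn: "(\<integral>\<^sup>+x. h x * indicator {a..b} x \<partial>lborel) = ennreal (F b - F a)" if "a \<le> b" for a b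
    using mu_Icc[OF that] emeasure_density[of h lborel "{a..b}"] dens by auto
  \<comment> \<open>The density takes extended values; its integral over each
    \<open>{- n..n}\<close> is the finite number \<open>F n - F (- n)\<close>, so it is finite
    almost everywhere and \<open>enn2real\<close> loses nothing.\<close>
  have fin: "AE x in lborel. h x \<noteq> \<infinity>"
  proof -
    have "AE x in lborel. h x * indicator {- real n..real n} x \<noteq> \<infinity>" for n
      by (rule nn_integral_PInf_AE) (use nn[of "- real n" "real n"] in auto)
    then have "AE x in lborel. \<forall>n. h x * indicator {- real n..real n} x \<noteq> \<infinity>"
      by (simp add: AE_all_countable)
    then show ?thesis
    proof eventually_elim
      case (elim x)
      obtain n where "\<bar>x\<bar> \<le> real n" using real_arch_simple by blast
      then have "x \<in> {- real n..real n}" by auto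
      with elim[rule_format, of n] show ?case by auto
    qed
  qed
  define k where "k x = enn2real (h x)" for x
  have kint: "(k has_integral (F b - F a)) {a..b}" if "a \<le> b" for a b
  proof -
    have "(\<integral>\<^sup>+x. ennreal (k x * indicator {a..b} x) \<partial>lborel) = (\<integral>\<^sup>+x. h x * indicator {a..b} x \<partial>lborel)"
    proof (rule nn_integral_cong_AE)
      show "AE x in lborel. ennreal (k x * indicator {a..b} x) = h x * indicator {a..b} x"
        using fin by eventually_elim (auto simp: k_def indicator_def less_top)
    qed
    then have "((\<lambda>x. k x * indicator {a..b} x) has_integral (F b - F a)) UNIV"
      using nn[OF that] leF that
      by (intro nn_integral_has_integral) (auto simp: k_def)
    then have "((\<lambda>x. if x \<in> {a..b} then k x else 0) has_integral (F b - F a)) UNIV"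
      by (rule has_integral_eq[rotated]) auto
    then show ?thesis by (simp only: has_integral_restrict_UNIV)
  qed
  have "((\<lambda>x. k x - (L + 1)) has_integral (f b - f a)) {a..b}" if "a \<le> b" for a b
    using has_integral_diff[OF kint[OF that] has_integral_const_real[of "L+1" a b]] that
    by (simp add: F_def algebra_simps)
  then show ?thesis using that by blast
qed

lemma has_real_derivative_if_one_sided:
  fixes f :: "real \<Rightarrow> real"
  assumes "\<And>e. e > 0 \<Longrightarrow> \<exists>d>0. \<forall>h. 0 < h \<and> h < d \<longrightarrow> \<bar>(f (x + h) - f x) / h - D\<bar> < e"
    and "\<And>e. e > 0 \<Longrightarrow> \<exists>d>0. \<forall>h. 0 < h \<and> h < d \<longrightarrow> \<bar>(f x - f (x - h)) / h - D\<bar> < e"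
  shows "(f has_real_derivative D) (at x)"
proof -
  have "\<exists>d>0. \<forall>h. h \<noteq> 0 \<and> \<bar>h\<bar> < d \<longrightarrow> \<bar>(f (x + h) - f x) / h - D\<bar> < e" if "e > 0" for e
  proof -
    obtain d1 where "d1>0" and d1: "\<And>h. 0 < h \<and> h < d1 \<Longrightarrow> \<bar>(f (x + h) - f x) / h - D\<bar> < e" using assms(1)[OF \<open>e > 0\<close>] by metis
    obtain d2 where "d2>0" and d2: "\<And>h. 0 < h \<and> h < d2 \<Longrightarrow> \<bar>(f x - f (x - h)) / h - D\<bar> < e" using assms(2)[OF \<open>e > 0\<close>] by metis
    have "\<bar>(f (x + h) - f x) / h - D\<bar> < e" if "h \<noteq> 0" "\<bar>h\<bar> < min d1 d2" for h
    proof (cases "h > 0")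
      case False
      have "(f (x + h) - f x) / h = (f x - f (x - (-h))) / (-h)" using that by (simp add: divide_simps)
      then show ?thesis using d2[of "-h"] that False by auto
    qed (use d1[of h] that in auto)
    then show ?thesis using \<open>d1>0\<close> \<open>d2>0\<close> by (intro exI[of _ "min d1 d2"]) auto
  qed
  then show ?thesis
    unfolding DERIV_def LIM_def by (auto simp: dist_real_def)
qed

text \<open>Averages of the density over \<open>{x..x + h}\<close> with \<open>h > 0\<close> give
  the right difference quotients. The left ones are right averages of the reflected density at
  \<open>- x\<close>, which is why a second exceptional set appears and is reflected back.\<close>

lemma lipschitz_real_differentiable_ae:
  fixes f :: "real \<Rightarrow> real"
  assumes lip: "L-lipschitz_on UNIV f"
  obtains N where "negligible N" "\<And>x. x \<notin> N \<Longrightarrow> \<exists>D. (f has_real_derivative D) (at x)"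
proof -
  obtain k where k: "\<And>a b. a \<le> b \<Longrightarrow> (k has_integral (f b - f a)) {a..b}"
    using lipschitz_real_density[OF lip] by blast
  have kr: "((\<lambda>x. k (- x)) has_integral (f (-a) - f (-b))) {a..b}" if "a \<le> b" for a b
    using k[of "-b" "-a"] that has_integral_reflect_real[of k "f (-a) - f (-b)" "-a" "-b"] by simp
  have ki: "k integrable_on cbox a b" for a b
    using k[of a b] by (cases "a \<le> b") (auto simp: integrable_on_def)
  have kri: "(\<lambda>x. k (-x)) integrable_on cbox a b" for a b
    using kr[of a b] by (cases "a \<le> b") (auto simp: integrable_on_def)
  obtain N1 where N1: "negligible N1"
    "\<And>x e. \<lbrakk>x \<notin> N1; 0 < e\<rbrakk> \<Longrightarrow> \<exists>d>0. \<forall>h. 0 < h \<and> h < d \<longrightarrow>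
       norm(integral (cbox x (x + h *\<^sub>R One)) k /\<^sub>R h ^ DIM(real) - k x) < e"
    using integrable_ccontinuous_explicit[OF ki] by metis
  obtain N2 where N2: "negligible N2"
    "\<And>x e. \<lbrakk>x \<notin> N2; 0 < e\<rbrakk> \<Longrightarrow> \<exists>d>0. \<forall>h. 0 < h \<and> h < d \<longrightarrow>
       norm(integral (cbox x (x + h *\<^sub>R One)) (\<lambda>x. k (-x)) /\<^sub>R h ^ DIM(real) - k (-x)) < e"
    using integrable_ccontinuous_explicit[OF kri] by metis
  show ?thesis
  proof
    have "negligible (uminus ` N2)"
    proof (rule negligible_locally_Lipschitz_image[OF order_refl N2(1)])
      show "\<exists>T B. open T \<and> x \<in> T \<and> (\<forall>y\<in>N2 \<inter> T. norm (- y - - x) \<le> B * norm (y - x))" for x :: real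
        by (rule exI[of _ UNIV], rule exI[of _ 1]) (simp add: abs_minus_commute)
    qed
    then show "negligible (N1 \<union> uminus ` N2)"
      using N1(1) by (simp add: negligible_Un)
    fix x assume x: "x \<notin> N1 \<union> uminus ` N2"
    then have x1: "x \<notin> N1" and x2: "- x \<notin> N2" by (auto simp: image_iff)
    show "\<exists>D. (f has_real_derivative D) (at x)"
    proof (rule exI[of _ "k x"], rule has_real_derivative_if_one_sided)
      fix e :: real assume "e > 0"
      have "integral {x..x + h} k = f (x + h) - f x" if "h > 0" for h
        using k[of x "x + h"] that by (simp add: integral_unique)
      then show "\<exists>d>0. \<forall>h. 0 < h \<and> h < d \<longrightarrow> \<bar>(f (x + h) - f x) / h - k x\<bar> < e"
        using N1(2)[OF x1 \<open>e>0\<close>] by (auto simp: divide_inverse mult.commute)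
      have "integral {-x..-x + h} (\<lambda>x. k (-x)) = f x - f (x - h)" if "h > 0" for h
        using kr[of "-x" "-x + h"] that by (simp add: integral_unique)
      then show "\<exists>d>0. \<forall>h. 0 < h \<and> h < d \<longrightarrow> \<bar>(f x - f (x - h)) / h - k x\<bar> < e"
        using N2(2)[OF x2 \<open>e>0\<close>] by (auto simp: divide_inverse mult.commute)
    qed
  qed
qed

section \<open>Directional derivatives off a null set\<close>

text \<open>By translation invariance the measure of \<open>A\<close> is the average over
  \<open>t\<close> in \<open>{0..1}\<close> of the measures of its translates along
  \<open>u\<close>. Exchanging the integrals leaves inner integrals over the lines, which vanish.
  This handles any direction without a change of coordinates.\<close>

lemma null_sets_if_null_on_lines:
  fixes A :: "'a::euclidean_space set" and u :: 'a
  assumes A[measurable]: "A \<in> sets borel"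
    and line: "\<And>x. emeasure lborel {t::real. x + t *\<^sub>R u \<in> A} = 0"
  shows "A \<in> null_sets lborel"
proof -
  have trans: "(\<integral>\<^sup>+x. indicator A (x + t *\<^sub>R u) \<partial>lborel) = emeasure lborel A" for t
  proof -
    have "emeasure lborel A = (\<integral>\<^sup>+x. indicator A x \<partial>(distr lborel borel ((+) (t *\<^sub>R u))))"
      by (simp add: lborel_distr_plus)
    also have "\<dots> = (\<integral>\<^sup>+x. indicator A (t *\<^sub>R u + x) \<partial>lborel)"
      by (rule nn_integral_distr) auto
    finally show ?thesis by (simp add: add.commute)
  qed
  have "emeasure lborel A = (\<integral>\<^sup>+t. emeasure lborel A * indicator {0..1::real} t \<partial>lborel)"
    by (simp add: nn_integral_cmult_indicator)
  also have "\<dots> = (\<integral>\<^sup>+t. (\<integral>\<^sup>+x. indicator A (x + t *\<^sub>R u) * indicator {0..1} t \<partial>lborel) \<partial>lborel)"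
    by (simp add: trans nn_integral_multc)
  also have "\<dots> = (\<integral>\<^sup>+x. (\<integral>\<^sup>+t. indicator A (x + t *\<^sub>R u) * indicator {0..1::real} t \<partial>lborel) \<partial>lborel)"
    by (rule lborel_pair.Fubini') measurable
  also have "\<dots> = (\<integral>\<^sup>+x. 0 \<partial>(lborel :: 'a measure))"
  proof (rule nn_integral_cong)
    fix x :: 'a
    have "(\<integral>\<^sup>+t. indicator A (x + t *\<^sub>R u) * indicator {0..1::real} t \<partial>lborel)
        \<le> (\<integral>\<^sup>+t. indicator {t. x + t *\<^sub>R u \<in> A} t \<partial>lborel)"
      by (rule nn_integral_mono) (auto simp: indicator_def)
    also have "\<dots> = emeasure lborel {t. x + t *\<^sub>R u \<in> A}"
    proof (rule nn_integral_indicator)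
      have "(\<lambda>t::real. x + t *\<^sub>R u) -` A \<inter> space borel \<in> sets borel"
        by (rule measurable_sets[OF _ A]) measurable
      then show "{t. x + t *\<^sub>R u \<in> A} \<in> sets lborel" by (simp add: vimage_def)
    qed
    finally show "(\<integral>\<^sup>+t. indicator A (x + t *\<^sub>R u) * indicator {0..1::real} t \<partial>lborel) = 0"
      using line by simp
  qed
  finally show ?thesis using A by (intro null_setsI) auto
qed

text \<open>The derivative is two-sided, so negative increments are available and
  \<open>has_dir_deriv_scaleR\<close> covers negative factors.\<close>

definition has_dir_deriv :: "('a::real_normed_vector \<Rightarrow> real) \<Rightarrow> 'a \<Rightarrow> 'a \<Rightarrow> real \<Rightarrow> bool" where
  "has_dir_deriv f x u D \<longleftrightarrow> ((\<lambda>s. f (x + s *\<^sub>R u)) has_real_derivative D) (at 0)"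

lemma has_dir_deriv_iff:
  "has_dir_deriv f x u D \<longleftrightarrow> ((\<lambda>s. (f (x + s *\<^sub>R u) - f x) / s) \<longlongrightarrow> D) (at 0)"
  by (simp add: has_dir_deriv_def DERIV_def)

text \<open>On each line of direction \<open>u\<close> the one-dimensional theorem applies. To
  integrate over the lines, the good set must be Borel, so existence of the limit is expressed by a
  Cauchy criterion.\<close>

lemma lipschitz_has_dir_deriv_ae:
  fixes f :: "'a::euclidean_space \<Rightarrow> real"
  assumes lip: "L-lipschitz_on UNIV f"
  shows "\<exists>N\<in>null_sets lborel. \<forall>x. x \<notin> N \<longrightarrow> (\<exists>D. has_dir_deriv f x u D)"
proof -
  have fc: "continuous_on UNIV f" using lip by (rule lipschitz_on_continuous_on)
  define q where "q s x = (f (x + s *\<^sub>R u) - f x) / s" for s :: real and x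
  have qc: "continuous_on UNIV (q s)" for s
    unfolding q_def divide_inverse
    by (intro continuous_intros continuous_on_compose2[OF fc]) auto
  \<comment> \<open>For fixed increments the condition is closed in \<open>x\<close>, since
    \<open>q s\<close> is continuous; an intersection over all real \<open>s\<close> and
    \<open>t\<close> stays closed, so only \<open>n\<close> and \<open>m\<close> have to be
    countable.\<close>
  define C where "C n m = {x. \<forall>s t. 0 < \<bar>s\<bar> \<and> \<bar>s\<bar> < 1 / Suc m \<and> 0 < \<bar>t\<bar> \<and> \<bar>t\<bar> < 1 / Suc m \<longrightarrow>
      \<bar>q s x - q t x\<bar> \<le> 1 / Suc n}" for n m :: nat
  have Ccl: "closed (C n m)" for n m
    unfolding C_def by (intro closed_Collect_all closed_Collect_imp open_Collect_const closed_Collect_le continuous_intros qc)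
  define D where "D = (\<Inter>n. \<Union>m. C n m)"
  have Db: "D \<in> sets borel" unfolding D_def using Ccl by (auto intro!: sets.countable_INT sets.countable_UN borel_closed)
  have deriv: "\<exists>d. has_dir_deriv f x u d" if xD: "x \<in> D" for x
  proof -
    have "cauchy_filter (filtermap (\<lambda>s. q s x) (at 0))"
      unfolding cauchy_filter_metric_filtermap
    proof (intro allI impI)
      fix e :: real assume "e > 0"
      then obtain n where n: "1 / Suc n < e" using nat_approx_posE by blast
      obtain m where "x \<in> C n m" using xD unfolding D_def by blast
      then have "\<bar>q s x - q t x\<bar> < e" if "0 < \<bar>s\<bar>" "\<bar>s\<bar> < 1 / Suc m" "0 < \<bar>t\<bar>" "\<bar>t\<bar> < 1 / Suc m" for s t
        using that n unfolding C_def by fastforce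
      moreover have "eventually (\<lambda>s. 0 < \<bar>s\<bar> \<and> \<bar>s\<bar> < 1 / Suc m) (at (0::real))"
        unfolding eventually_at by (intro exI[of _ "1 / Suc m"]) auto
      ultimately show "\<exists>P. eventually P (at 0) \<and> (\<forall>s t. P s \<and> P t \<longrightarrow> dist (q s x) (q t x) < e)"
        by (intro exI[of _ "\<lambda>s. 0 < \<bar>s\<bar> \<and> \<bar>s\<bar> < 1 / Suc m"]) (auto simp: dist_real_def)
    qed
    then obtain d where "filtermap (\<lambda>s. q s x) (at 0) \<le> nhds d"
      using cauchy_filter_complete_converges[OF _ complete_UNIV, of "filtermap (\<lambda>s. q s x) (at 0)"]
      by (auto simp: filtermap_bot_iff)
    then have "((\<lambda>s. q s x) \<longlongrightarrow> d) (at 0)" by (simp add: filterlim_def)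
    then show ?thesis unfolding has_dir_deriv_iff q_def by blast
  qed
  have line: "{t. x + t *\<^sub>R u \<in> -D} \<in> null_sets lborel" for x
  proof -
    define \<phi> where "\<phi> t = f (x + t *\<^sub>R u)" for t
    have "(L * norm u)-lipschitz_on UNIV \<phi>"
    proof (rule lipschitz_onI)
      show "dist (\<phi> s) (\<phi> t) \<le> L * norm u * dist s t" for s t
        using lipschitz_onD[OF lip, of "x + s *\<^sub>R u" "x + t *\<^sub>R u"]
        by (simp add: \<phi>_def dist_norm scaleR_left_diff_distrib[symmetric] mult_ac)
      show "0 \<le> L * norm u" using lipschitz_on_nonneg[OF lip] by simp
    qed
    from lipschitz_real_differentiable_ae[OF this] obtain N where N: "negligible N"
      "\<And>t. t \<notin> N \<Longrightarrow> \<exists>D. (\<phi> has_real_derivative D) (at t)" by blast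
    have "{t. x + t *\<^sub>R u \<in> -D} \<subseteq> N"
    proof
      fix t assume t: "t \<in> {t. x + t *\<^sub>R u \<in> -D}"
      show "t \<in> N"
      proof (rule ccontr)
        assume "t \<notin> N"
        then obtain d where d: "(\<phi> has_real_derivative d) (at t)" using N(2) by blast
        have "((\<lambda>s. q s (x + t *\<^sub>R u)) \<longlongrightarrow> d) (at 0)"
          using d unfolding DERIV_def \<phi>_def q_def by (simp add: algebra_simps)
        have "x + t *\<^sub>R u \<in> D"
          unfolding D_def
        proof (rule INT_I)
          fix n :: nat
          define e where "e = 1 / real (Suc n)"
          have "e / 2 > 0" by (simp add: e_def)
          then have "\<exists>r>0. \<forall>s. s \<noteq> 0 \<and> \<bar>s\<bar> < r \<longrightarrow> \<bar>q s (x + t *\<^sub>R u) - d\<bar> < e / 2"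
            using LIM_D[OF \<open>((\<lambda>s. q s (x + t *\<^sub>R u)) \<longlongrightarrow> d) (at 0)\<close>, of "e / 2"]
            by (simp only: real_norm_def diff_0_right)
          then obtain r where "r > 0"
            and r: "\<And>s. s \<noteq> 0 \<Longrightarrow> \<bar>s\<bar> < r \<Longrightarrow> \<bar>q s (x + t *\<^sub>R u) - d\<bar> < e / 2"
            by blast
          obtain m where m: "1 / Suc m < r" using nat_approx_posE[OF \<open>r > 0\<close>] by blast
          have "\<bar>q s (x + t *\<^sub>R u) - q s' (x + t *\<^sub>R u)\<bar> \<le> 1 / Suc n"
            if ss: "0 < \<bar>s\<bar> \<and> \<bar>s\<bar> < 1 / Suc m \<and> 0 < \<bar>s'\<bar> \<and> \<bar>s'\<bar> < 1 / Suc m" for s s'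
          proof -
            have "s \<noteq> 0" "\<bar>s\<bar> < r" "s' \<noteq> 0" "\<bar>s'\<bar> < r" using ss m by (auto simp del: of_nat_Suc)
            then have "\<bar>q s (x + t *\<^sub>R u) - d\<bar> < e / 2" "\<bar>q s' (x + t *\<^sub>R u) - d\<bar> < e / 2" using r by blast+
            then show ?thesis unfolding e_def[symmetric] by linarith
          qed
          then have "x + t *\<^sub>R u \<in> C n m" unfolding C_def by blast
          then show "x + t *\<^sub>R u \<in> (\<Union>m. C n m)" by blast
        qed
        with t show False by simp
      qed
    qed
    then have "negligible {t. x + t *\<^sub>R u \<in> -D}" using N(1) negligible_subset by blast
    moreover have "{t. x + t *\<^sub>R u \<in> -D} \<in> sets borel"
    proof -
      have "(\<lambda>t::real. x + t *\<^sub>R u) -` (-D) \<inter> space borel \<in> sets borel"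
        by (rule measurable_sets[of _ borel borel]) (use Db in auto)
      then show ?thesis by (simp add: vimage_def)
    qed
    ultimately show ?thesis by (simp add: negligible_iff_null_sets null_sets_completion_iff)
  qed
  have "-D \<in> null_sets lborel"
    by (rule null_sets_if_null_on_lines[where u=u]) (use Db line in \<open>auto dest: null_setsD1\<close>)
  then show ?thesis using deriv by (intro bexI[of _ "-D"]) auto
qed

text \<open>If \<open>x\<close> and \<open>x + s (u + v)\<close> both lie in the exceptional set, then the increment from one to the
  other, split at \<open>x + s u\<close>, is both \<open>\<ge> w s\<close> and \<open>\<le> (y + z) s\<close>. Hence the set is
  discrete on every line of direction \<open>u + v\<close> (Nekvinda and Zajicek).\<close>

lemma dir_deriv_superadditive_null:
  fixes f :: "'a::euclidean_space \<Rightarrow> real"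
  assumes lip: "L-lipschitz_on UNIV f"
  obtains N where "N \<in> null_sets lborel"
    "\<And>x a b c. \<lbrakk>x \<notin> N; has_dir_deriv f x u a; has_dir_deriv f x v b; has_dir_deriv f x (u + v) c\<rbrakk> \<Longrightarrow> c \<le> a + b"
proof -
  have fc: "continuous_on UNIV f" using lip by (rule lipschitz_on_continuous_on)
  define A where "A y z w m = {x. \<forall>s. 0 < \<bar>s\<bar> \<and> \<bar>s\<bar> < 1 / Suc m \<longrightarrow>
      (f (x + s *\<^sub>R u) - f x) / s \<le> y \<and> (f (x + s *\<^sub>R v) - f x) / s \<le> z \<and> w \<le> (f (x + s *\<^sub>R (u + v)) - f x) / s}"
    for y z w :: real and m :: nat
  have Acl: "closed (A y z w m)" for y z w m
    unfolding A_def divide_inverse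
    by (intro closed_Collect_all closed_Collect_imp open_Collect_const closed_Collect_conj closed_Collect_le
        continuous_intros continuous_on_compose2[OF fc]) auto
  have Anull: "A y z w m \<in> null_sets lborel" if yzw: "y + z < w" for y z w m
  proof (rule null_sets_if_null_on_lines[where u="u + v"])
    show "A y z w m \<in> sets borel" using Acl by (rule borel_closed)
    fix x
    have sep: "\<not> (0 < s \<and> s < 1 / Suc m)" if "p \<in> A y z w m" "p + s *\<^sub>R (u + v) \<in> A y z w m" for p s
    proof
      assume s: "0 < s \<and> s < 1 / Suc m"
      have "(f (p + s *\<^sub>R u) - f p) / s \<le> y \<and> w \<le> (f (p + s *\<^sub>R (u + v)) - f p) / s"
        using that(1) s unfolding A_def by (auto dest!: spec[of _ s])
      then have 1: "f (p + s *\<^sub>R u) - f p \<le> y * s" and 2: "w * s \<le> f (p + s *\<^sub>R (u + v)) - f p"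
        using s by (simp_all add: pos_divide_le_eq pos_le_divide_eq)
      \<comment> \<open>The bound on the quotients in direction \<open>v\<close> is used at the far
        endpoint with the negative increment \<open>- s\<close>, which leads back to the common
        intermediate point \<open>p + s u\<close>.\<close>
      have "(f (p + s *\<^sub>R (u + v) + (-s) *\<^sub>R v) - f (p + s *\<^sub>R (u + v))) / (-s) \<le> z"
        using that(2) s unfolding A_def by (auto dest!: spec[of _ "-s"])
      moreover have "p + s *\<^sub>R (u + v) + (-s) *\<^sub>R v = p + s *\<^sub>R u" by (simp add: algebra_simps)
      ultimately have "(f (p + s *\<^sub>R u) - f (p + s *\<^sub>R (u + v))) / (-s) \<le> z" by (simp only:)
      then have 3: "f (p + s *\<^sub>R (u + v)) - f (p + s *\<^sub>R u) \<le> z * s"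
        using s by (simp add: field_simps)
      from 1 2 3 have "w * s \<le> (y + z) * s" by (simp add: algebra_simps)
      then show False using s yzw by simp
    qed
    let ?T = "{t. x + t *\<^sub>R (u + v) \<in> A y z w m}"
    \<comment> \<open>Distinct parameters in \<open>?T\<close> are at least \<open>1 / Suc m\<close>
      apart. Scaled by \<open>2 * Suc m\<close> they differ by more than 1, so their integer parts
      differ and \<open>?T\<close> is countable.\<close>
    have "inj_on (\<lambda>t. \<lfloor>t * (2 * Suc m)\<rfloor>) ?T"
    proof (rule linorder_inj_onI)
      fix t t' assume t: "t < t'" "t \<in> ?T" "t' \<in> ?T"
      have "x + t *\<^sub>R (u + v) + (t' - t) *\<^sub>R (u + v) = x + t' *\<^sub>R (u + v)" by (simp add: algebra_simps)
      then have "x + t *\<^sub>R (u + v) + (t' - t) *\<^sub>R (u + v) \<in> A y z w m"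
        using t(3) by (simp only: mem_Collect_eq)
      then have "1 / Suc m \<le> t' - t"
        using sep[of "x + t *\<^sub>R (u + v)" "t' - t"] t(1,2) by (simp only: mem_Collect_eq) argo
      then have "1 \<le> (t' - t) * Suc m" by (simp add: field_simps)
      then have "t * (2 * Suc m) + 1 \<le> t' * (2 * Suc m)" by (simp add: algebra_simps)
      then show "\<lfloor>t * (2 * Suc m)\<rfloor> \<noteq> \<lfloor>t' * (2 * Suc m)\<rfloor>" by linarith
    qed auto
    then have "countable ?T" by (rule countableI')
    then show "emeasure lborel ?T = 0" by (rule emeasure_lborel_countable)
  qed
  \<comment> \<open>Rational thresholds with \<open>y + z < w\<close> reduce the failure of
    \<open>c \<le> a + b\<close> to countably many null sets. A quarter of the gap is enough room
    for choosing them: \<open>a\<close> and \<open>b\<close> are raised and \<open>c\<close> is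
    lowered by less than that.\<close>
  define N where "N = (\<Union>(y, z, w) \<in> {(y, z, w). y \<in> \<rat> \<and> z \<in> \<rat> \<and> w \<in> \<rat> \<and> y + z < w}. \<Union>m. A y z w m)"
  have "countable {(y::real, z::real, w::real). y \<in> \<rat> \<and> z \<in> \<rat> \<and> w \<in> \<rat> \<and> y + z < w}"
    by (rule countable_subset[of _ "\<rat> \<times> \<rat> \<times> \<rat>"]) (auto intro!: countable_SIGMA countable_rat)
  then have "N \<in> null_sets lborel"
    unfolding N_def using Anull by (intro null_sets_UN') auto
  moreover have "c \<le> a + b" if "x \<notin> N" and a: "has_dir_deriv f x u a" and b: "has_dir_deriv f x v b"
    and c: "has_dir_deriv f x (u + v) c" for x a b c
  proof (rule ccontr)
    assume "\<not> c \<le> a + b"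
    then have e: "(c - a - b) / 4 > 0" (is "?e > 0") by simp
    obtain y where y: "y \<in> \<rat>" "a < y" "y < a + ?e" using Rats_dense_in_real[of a "a + ?e"] e by auto
    obtain z where z: "z \<in> \<rat>" "b < z" "z < b + ?e" using Rats_dense_in_real[of b "b + ?e"] e by auto
    obtain w where w: "w \<in> \<rat>" "c - ?e < w" "w < c" using Rats_dense_in_real[of "c - ?e" c] e by auto
    have "y + z < w" using y z w by (simp add: field_simps)
    have "\<forall>\<^sub>F s in at 0. (f (x + s *\<^sub>R u) - f x) / s < y \<and> (f (x + s *\<^sub>R v) - f x) / s < z \<and> w < (f (x + s *\<^sub>R (u + v)) - f x) / s"
      using a b c y z w unfolding has_dir_deriv_iff
      by (intro eventually_conj) (auto dest: order_tendstoD)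
    then obtain r where "r > 0" and r: "\<And>s. s \<noteq> 0 \<Longrightarrow> \<bar>s\<bar> < r \<Longrightarrow> (f (x + s *\<^sub>R u) - f x) / s < y \<and>
        (f (x + s *\<^sub>R v) - f x) / s < z \<and> w < (f (x + s *\<^sub>R (u + v)) - f x) / s"
      unfolding eventually_at by (auto simp: dist_real_def)
    obtain m where m: "1 / Suc m < r" using nat_approx_posE[OF \<open>r > 0\<close>] by blast
    have "x \<in> A y z w m" unfolding A_def using r m by (force simp: less_imp_le)
    then have "x \<in> N" unfolding N_def using y z w \<open>y + z < w\<close> by blast
    then show False using \<open>x \<notin> N\<close> by simp
  qed
  ultimately show ?thesis using that by blast
qed

text \<open>The reverse inequality is the one-sided result for \<open>- f\<close>, whose directional
  derivatives are the negatives.\<close>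

lemma dir_deriv_additive_ae:
  fixes f :: "'a::euclidean_space \<Rightarrow> real"
  assumes lip: "L-lipschitz_on UNIV f"
  shows "\<exists>N\<in>null_sets lborel. \<forall>x a b c. x \<notin> N \<longrightarrow>
    has_dir_deriv f x u a \<longrightarrow> has_dir_deriv f x v b \<longrightarrow> has_dir_deriv f x (u + v) c \<longrightarrow> c = a + b"
proof -
  obtain N1 where N1: "N1 \<in> null_sets lborel"
    "\<And>x a b c. \<lbrakk>x \<notin> N1; has_dir_deriv f x u a; has_dir_deriv f x v b; has_dir_deriv f x (u + v) c\<rbrakk> \<Longrightarrow> c \<le> a + b"
    using dir_deriv_superadditive_null[OF lip, of u v] by metis
  have lip': "L-lipschitz_on UNIV (\<lambda>x. - f x)"
    using lip by simp
  obtain N2 where N2: "N2 \<in> null_sets lborel"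
    "\<And>x a b c. \<lbrakk>x \<notin> N2; has_dir_deriv (\<lambda>x. - f x) x u a; has_dir_deriv (\<lambda>x. - f x) x v b;
       has_dir_deriv (\<lambda>x. - f x) x (u + v) c\<rbrakk> \<Longrightarrow> c \<le> a + b"
    using dir_deriv_superadditive_null[OF lip', of u v] by metis
  have neg: "has_dir_deriv (\<lambda>x. - f x) x u (- a)" if "has_dir_deriv f x u a" for x u a
    using that unfolding has_dir_deriv_def by (rule DERIV_minus)
  show ?thesis
  proof (intro bexI[of _ "N1 \<union> N2"] allI impI)
    show "N1 \<union> N2 \<in> null_sets lborel" using N1(1) N2(1) by blast
    fix x a b c
    assume x: "x \<notin> N1 \<union> N2" "has_dir_deriv f x u a" "has_dir_deriv f x v b" "has_dir_deriv f x (u + v) c"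
    have "c \<le> a + b" using N1(2) x by blast
    moreover have "- c \<le> - a + - b" using N2(2)[of x "-a" "-b" "-c"] x neg by blast
    ultimately show "c = a + b" by simp
  qed
qed

lemma has_dir_deriv_scaleR:
  assumes "has_dir_deriv f x u D"
  shows "has_dir_deriv f x (c *\<^sub>R u) (c * D)"
proof -
  have "((\<lambda>s. f (x + s *\<^sub>R u)) has_real_derivative D) (at (c * 0))"
    using assms by (simp add: has_dir_deriv_def)
  moreover have "((\<lambda>s. c * s) has_real_derivative c) (at 0)"
    by (auto intro!: derivative_eq_intros)
  ultimately have "((\<lambda>s. f (x + (c * s) *\<^sub>R u)) has_real_derivative D * c) (at 0)"
    by (rule DERIV_chain2)
  then show ?thesis unfolding has_dir_deriv_def by (simp add: mult.commute)
qed

section \<open>From directional derivatives to gradients\<close>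

text \<open>Compactness of the unit sphere gives a finite net of directions in \<open>Q\<close>, on
  which the difference quotients converge uniformly. The Lipschitz bound transfers the estimate from
  a net point to every nearby direction.\<close>

lemma GDERIV_if_dir_deriv_dense:
  fixes f :: "'a::euclidean_space \<Rightarrow> real"
  assumes lip: "L-lipschitz_on UNIV f" and dense: "closure Q = UNIV"
    and dd: "\<And>u. u \<in> Q \<Longrightarrow> has_dir_deriv f x u (u \<bullet> g)"
  shows "GDERIV f x :> g"
proof -
  have L0: "L \<ge> 0" using lip lipschitz_on_nonneg by blast
  have fl: "\<bar>f y - f z\<bar> \<le> L * norm (y - z)" for y z
    using lipschitz_onD[OF lip, of y z] by (simp add: dist_norm)
  define R where "R h = f (x + h) - f x - h \<bullet> g" for h
  have "\<exists>d>0. \<forall>h. norm h < d \<longrightarrow> \<bar>R h\<bar> \<le> e * norm h" if "e > 0" for e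
  proof -
    \<comment> \<open>Three errors share \<open>e\<close>: the quotient along the net direction
      (\<open>e'\<close>), the change of \<open>f\<close> between directions (\<open>L * e'\<close>)
      and the change of the linear part (\<open>norm g * e'\<close>).\<close>
    define e' where "e' = e / (L + norm g + 1)"
    have den: "L + norm g + 1 > 0" using L0 by (simp add: add_nonneg_pos)
    then have e': "e' > 0" using \<open>e > 0\<close> by (simp add: e'_def)
    have "sphere 0 1 \<subseteq> (\<Union>q\<in>Q. ball q e')"
    proof
      fix w :: 'a
      obtain q where "q \<in> Q" "dist q w < e'"
        using dense e' closure_approachable[of w Q] by auto
      then show "w \<in> (\<Union>q\<in>Q. ball q e')" by auto
    qed
    moreover have "compact (sphere (0::'a) 1)" by simp
    ultimately obtain T where T: "T \<subseteq> Q" "finite T" "sphere 0 1 \<subseteq> (\<Union>q\<in>T. ball q e')"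
      using compactE_image[of "sphere 0 1" Q "\<lambda>q. ball q e'"] by (metis open_ball)
    have "\<forall>q\<in>T. \<forall>\<^sub>F s in at_right 0. \<bar>R (s *\<^sub>R q)\<bar> \<le> e' * s"
    proof
      fix q assume "q \<in> T"
      then have "((\<lambda>s. (f (x + s *\<^sub>R q) - f x) / s) \<longlongrightarrow> q \<bullet> g) (at 0)"
        using dd T(1) has_dir_deriv_iff by blast
      then have "((\<lambda>s. (f (x + s *\<^sub>R q) - f x) / s) \<longlongrightarrow> q \<bullet> g) (at_right 0)"
        by (rule filterlim_mono) (auto simp: at_le)
      then have "\<forall>\<^sub>F s in at_right 0. dist ((f (x + s *\<^sub>R q) - f x) / s) (q \<bullet> g) < e'"
        using e' by (rule tendstoD)
      moreover have "\<forall>\<^sub>F s in at_right 0. (0::real) < s"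
        by (simp add: eventually_at_right_less)
      ultimately show "\<forall>\<^sub>F s in at_right 0. \<bar>R (s *\<^sub>R q)\<bar> \<le> e' * s"
      proof eventually_elim
        case (elim s)
        have "R (s *\<^sub>R q) = s * ((f (x + s *\<^sub>R q) - f x) / s - q \<bullet> g)"
          using elim by (simp add: R_def field_simps)
        then show ?case using elim by (simp add: dist_real_def abs_mult mult.commute)
      qed
    qed
    then have "\<forall>\<^sub>F s in at_right 0. \<forall>q\<in>T. \<bar>R (s *\<^sub>R q)\<bar> \<le> e' * s"
      using T(2) by (simp add: eventually_ball_finite_distrib)
    then obtain d where "d > 0" and d: "\<And>s q. 0 < s \<Longrightarrow> s < d \<Longrightarrow> q \<in> T \<Longrightarrow> \<bar>R (s *\<^sub>R q)\<bar> \<le> e' * s"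
      unfolding eventually_at_right_field by auto
    have "\<bar>R h\<bar> \<le> e * norm h" if "norm h < d" for h
    proof (cases "h = 0")
      case False
      define s w where "s = norm h" and "w = h /\<^sub>R norm h"
      have s: "0 < s" "s < d" and h: "h = s *\<^sub>R w" and "w \<in> sphere 0 1"
        using False that by (auto simp: s_def w_def)
      then obtain q where q: "q \<in> T" "dist q w < e'" using T(3) by auto
      have "\<bar>f (x + s *\<^sub>R w) - f (x + s *\<^sub>R q)\<bar> \<le> L * (s * e')"
      proof -
        have "\<bar>f (x + s *\<^sub>R w) - f (x + s *\<^sub>R q)\<bar> \<le> L * norm (s *\<^sub>R (w - q))"
          using fl[of "x + s *\<^sub>R w" "x + s *\<^sub>R q"] by (simp add: algebra_simps)
        also have "\<dots> \<le> L * (s * e')"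
          using q(2) s L0 by (intro mult_left_mono) (auto simp: dist_norm norm_minus_commute)
        finally show ?thesis .
      qed
      moreover have "\<bar>(s *\<^sub>R q) \<bullet> g - (s *\<^sub>R w) \<bullet> g\<bar> \<le> s * e' * norm g"
      proof -
        have "\<bar>(s *\<^sub>R (q - w)) \<bullet> g\<bar> \<le> norm (s *\<^sub>R (q - w)) * norm g" by (rule Cauchy_Schwarz_ineq2)
        also have "\<dots> \<le> s * e' * norm g"
          using q(2) s by (intro mult_right_mono) (auto simp: dist_norm)
        finally show ?thesis by (simp add: inner_diff_left algebra_simps)
      qed
      moreover have "\<bar>R (s *\<^sub>R q)\<bar> \<le> e' * s" using d s q by blast
      ultimately have "\<bar>R h\<bar> \<le> e' * s + L * (s * e') + s * e' * norm g"
        unfolding R_def h by linarith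
      also have "\<dots> = (e' * (L + norm g + 1)) * s" by (simp add: algebra_simps)
      also have "\<dots> = e * norm h" using den by (simp add: e'_def s_def)
      finally show ?thesis .
    qed (simp add: R_def)
    then show ?thesis using \<open>d > 0\<close> by blast
  qed
  note small = this
  have "(f has_derivative (\<lambda>h. h \<bullet> g)) (at x)"
    unfolding has_derivative_at_alt
  proof (intro conjI allI impI)
    show "bounded_linear (\<lambda>h. h \<bullet> g)" by (rule bounded_linear_inner_left)
    fix e :: real assume "e > 0"
    then obtain d where "d > 0" and d: "\<And>h. norm h < d \<Longrightarrow> \<bar>R h\<bar> \<le> e * norm h"
      using small by blast
    then show "\<exists>d>0. \<forall>y. norm (y - x) < d \<longrightarrow> norm (f y - f x - (y - x) \<bullet> g) \<le> e * norm (y - x)"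
      using d[of "_ - x"] by (intro exI[of _ d]) (auto simp: R_def)
  qed
  then show ?thesis by (simp add: gderiv_def)
qed

text \<open>The index set \<open>Basis \<rightarrow> \<rat>\<close> is itself uncountable, as values
  off \<open>Basis\<close> are free. Restriction to extensional functions keeps all the sums and
  leaves countably many indices.\<close>

lemma countable_rational_coordinates:
  "countable (\<Union>f \<in> Basis \<rightarrow> \<rat>. {\<Sum>i :: 'a :: euclidean_space \<in> Basis. f i *\<^sub>R i})" (is "countable ?Q")
proof -
  have "?Q \<subseteq> (\<lambda>f. \<Sum>i\<in>Basis. f i *\<^sub>R i) ` (PiE Basis (\<lambda>_. \<rat>))"
  proof clarify
    fix f :: "'a \<Rightarrow> real" assume "f \<in> Basis \<rightarrow> \<rat>"
    then show "(\<Sum>i\<in>Basis. f i *\<^sub>R i) \<in> (\<lambda>f. \<Sum>i\<in>Basis. f i *\<^sub>R i) ` (PiE Basis (\<lambda>_. \<rat>))"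
      by (intro image_eqI[of _ _ "restrict f Basis"]) auto
  qed
  moreover have "countable ((\<lambda>f. \<Sum>i::'a\<in>Basis. f i *\<^sub>R i) ` (PiE Basis (\<lambda>_. \<rat> :: real set)))"
    by (intro countable_image countable_PiE finite_Basis countable_rat)
  ultimately show ?thesis by (rule countable_subset)
qed

text \<open>Existence and additivity of directional derivatives each cost one null set per direction
  or pair of directions. Rational combinations of the basis are dense and countable, so one null set
  serves them all, and off it the derivatives along the basis vectors assemble into the
  gradient.\<close>

theorem rademacher:
  fixes f :: "'a::euclidean_space \<Rightarrow> real"
  assumes lip: "L-lipschitz_on UNIV f"
  shows "\<exists>N\<in>null_sets lborel. \<forall>x. x \<notin> N \<longrightarrow> (\<exists>g. GDERIV f x :> g)"
proof -
  define Q where "Q = (\<Union>f \<in> Basis \<rightarrow> \<rat>. {\<Sum>i :: 'a \<in> Basis. f i *\<^sub>R i})"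
  have cQ: "countable Q" unfolding Q_def by (rule countable_rational_coordinates)
  define good where "good N u \<longleftrightarrow> (\<forall>x. x \<notin> N \<longrightarrow> (\<exists>D. has_dir_deriv f x u D))" for N u
  define add where "add N p \<longleftrightarrow> (\<forall>x a b c. x \<notin> N \<longrightarrow> has_dir_deriv f x (fst p) a \<longrightarrow>
      has_dir_deriv f x (snd p) b \<longrightarrow> has_dir_deriv f x (fst p + snd p) c \<longrightarrow> c = a + b)" for N p
  have "\<exists>N\<in>null_sets lborel. good N u" for u
    unfolding good_def by (rule lipschitz_has_dir_deriv_ae[OF lip])
  then obtain N1 where N1: "\<And>u. N1 u \<in> null_sets lborel" "\<And>u. good (N1 u) u"
    by metis
  have "\<exists>N\<in>null_sets lborel. add N p" for p
    unfolding add_def by (rule dir_deriv_additive_ae[OF lip])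
  then obtain N2 where N2: "\<And>p. N2 p \<in> null_sets lborel" "\<And>p. add (N2 p) p"
    by metis
  define N where "N = (\<Union>u\<in>Q. N1 u) \<union> (\<Union>p\<in>Q \<times> Q. N2 p)"
  have "N \<in> null_sets lborel"
    unfolding N_def using N1(1) N2(1) cQ by (intro null_sets.Un null_sets_UN') (auto intro: countable_SIGMA)
  moreover have "\<exists>g. GDERIV f x :> g" if x: "x \<notin> N" for x
  proof -
    have ex: "\<exists>D. has_dir_deriv f x u D" if "u \<in> Q" for u
      using N1(2) x that unfolding N_def good_def by blast
    have add: "c = a + b" if "u \<in> Q" "v \<in> Q" "has_dir_deriv f x u a" "has_dir_deriv f x v b"
      "has_dir_deriv f x (u + v) c" for u v a b c
    proof -
      have "x \<notin> N2 (u, v)" using x that(1,2) unfolding N_def by blast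
      then show ?thesis using N2(2)[of "(u, v)"] that(3-5) unfolding add_def by auto
    qed
    have inQ: "(\<Sum>i\<in>S. q i *\<^sub>R i) \<in> Q" if "q \<in> Basis \<rightarrow> \<rat>" "S \<subseteq> Basis" for q and S :: "'a set"
    proof -
      have "(\<Sum>i\<in>S. q i *\<^sub>R i) = (\<Sum>i\<in>Basis. (if i \<in> S then q i else 0) *\<^sub>R i)"
        using that(2) by (intro sum.mono_neutral_cong_left) auto
      moreover have "(\<lambda>i. if i \<in> S then q i else 0) \<in> Basis \<rightarrow> \<rat>" using that(1) by auto
      ultimately show ?thesis unfolding Q_def by blast
    qed
    have BQ: "b \<in> Q" if "b \<in> Basis" for b
      using inQ[of "\<lambda>_. 1" "{b}"] that by auto
    obtain a where a: "\<And>b. b \<in> Basis \<Longrightarrow> has_dir_deriv f x b (a b)"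
      using ex BQ by metis
    define g where "g = (\<Sum>b\<in>Basis. a b *\<^sub>R b)"
    \<comment> \<open>Additivity is known only between members of \<open>Q\<close>. The induction
      adds one basis vector at a time, so that all partial sums remain in \<open>Q\<close>.\<close>
    have dQ: "has_dir_deriv f x (\<Sum>i\<in>S. q i *\<^sub>R i) (\<Sum>i\<in>S. q i * a i)"
      if q: "q \<in> Basis \<rightarrow> \<rat>" and "S \<subseteq> Basis" for q S
      using finite_subset[OF that(2) finite_Basis] that(2)
    proof (induction S)
      case empty
      show ?case by (simp add: has_dir_deriv_def)
    next
      case (insert i S)
      let ?u = "\<Sum>i\<in>S. q i *\<^sub>R i" and ?v = "q i *\<^sub>R i"
      have u: "?u \<in> Q" using inQ q insert.prems by auto
      have v: "?v \<in> Q" using inQ[OF q, of "{i}"] insert.prems by auto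
      have uv: "?u + ?v \<in> Q" using inQ[OF q insert.prems] insert.hyps by (simp add: add.commute)
      have "has_dir_deriv f x ?u (\<Sum>i\<in>S. q i * a i)" using insert by auto
      moreover have "has_dir_deriv f x ?v (q i * a i)" using a insert.prems by (intro has_dir_deriv_scaleR) auto
      moreover obtain c where c: "has_dir_deriv f x (?u + ?v) c" using ex uv by blast
      ultimately have "c = (\<Sum>i\<in>S. q i * a i) + q i * a i" using add u v by blast
      with c insert.hyps show ?case by (simp add: add.commute)
    qed
    have "GDERIV f x :> g"
    proof (rule GDERIV_if_dir_deriv_dense[OF lip])
      show "closure Q = UNIV" unfolding Q_def by (rule closure_rational_coordinates)
      fix u assume "u \<in> Q"
      then obtain q where q: "q \<in> Basis \<rightarrow> \<rat>" "u = (\<Sum>i\<in>Basis. q i *\<^sub>R i)" unfolding Q_def by blast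
      have "u \<bullet> g = (\<Sum>i\<in>Basis. (u \<bullet> i) * (g \<bullet> i))" by (rule euclidean_inner)
      also have "\<dots> = (\<Sum>i\<in>Basis. q i * a i)"
        unfolding q(2) g_def by (intro sum.cong) auto
      finally show "has_dir_deriv f x u (u \<bullet> g)" using dQ[OF q(1) order_refl] q(2) by simp
    qed
    then show ?thesis by blast
  qed
  ultimately show ?thesis by blast
qed

text \<open>The nearest-point map onto a closed ball is nonexpansive, so precomposing with it gives
  a globally Lipschitz function that equals \<open>f\<close> inside. A ball has positive measure and
  therefore meets the complement of the exceptional set.\<close>

lemma locally_lipschitz_GDERIV_dense:
  fixes f :: "'a::euclidean_space \<Rightarrow> real"
  assumes lip: "L-lipschitz_on (ball x r) f" and "r > 0" "e > 0"
  obtains y g where "dist y x < e" "GDERIV f y :> g"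
proof -
  define P where "P = closest_point (cball x (r / 2))"
  have ne: "cball x (r / 2) \<noteq> {}" using \<open>r > 0\<close> by simp
  have "L-lipschitz_on UNIV (f \<circ> P)"
  proof (rule lipschitz_onI)
    fix y z
    have "P y \<in> ball x r" "P z \<in> ball x r"
      using closest_point_in_set[OF closed_cball ne, of y] closest_point_in_set[OF closed_cball ne, of z] \<open>r > 0\<close>
      unfolding P_def by auto
    then have "dist (f (P y)) (f (P z)) \<le> L * dist (P y) (P z)" using lipschitz_onD[OF lip] by blast
    also have "\<dots> \<le> L * dist y z"
      unfolding P_def using lipschitz_on_nonneg[OF lip]
      by (intro mult_left_mono closest_point_lipschitz) (use \<open>r > 0\<close> in auto)
    finally show "dist ((f \<circ> P) y) ((f \<circ> P) z) \<le> L * dist y z" by simp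
  qed (rule lipschitz_on_nonneg[OF lip])
  then obtain N where N: "N \<in> null_sets lborel" "\<And>y. y \<notin> N \<Longrightarrow> \<exists>g. GDERIV (f \<circ> P) y :> g"
    using rademacher by blast
  define d where "d = min e (r / 2)"
  have "d > 0" using assms by (simp add: d_def)
  have "\<not> ball x d \<subseteq> N"
  proof
    assume "ball x d \<subseteq> N"
    then have "negligible (ball x d)"
      by (meson N(1) negligible_iff_null_sets negligible_subset null_sets_completionI)
    then show False using open_not_negligible[of "ball x d"] \<open>d > 0\<close> by simp
  qed
  then obtain y where y: "y \<in> ball x d" "y \<notin> N" by blast
  obtain g where "((f \<circ> P) has_derivative (\<lambda>h. h \<bullet> g)) (at y)" using N(2)[OF y(2)] by (auto simp: gderiv_def)
  then have "(f has_derivative (\<lambda>h. h \<bullet> g)) (at y)"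
  proof (rule has_derivative_transform_within_open[OF _ open_ball y(1)])
    fix z assume "z \<in> ball x d"
    then have "z \<in> cball x (r / 2)" by (auto simp: d_def)
    then show "(f \<circ> P) z = f z" by (simp add: P_def closest_point_self)
  qed
  then show ?thesis using that[of y g] y(1) by (simp add: gderiv_def d_def dist_commute)
qed

section \<open>Clarke and Goldstein subdifferentials\<close>

lemma GDERIV_has_dir_deriv:
  assumes "GDERIV f x :> g"
  shows "has_dir_deriv f x u (u \<bullet> g)"
proof -
  have "(f has_derivative (\<lambda>h. h \<bullet> g)) (at (x + 0 *\<^sub>R u))" using assms by (simp add: gderiv_def)
  moreover have "((\<lambda>s. x + s *\<^sub>R u) has_derivative (\<lambda>s. s *\<^sub>R u)) (at 0)"
    by (auto intro!: derivative_eq_intros)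
  ultimately have "((\<lambda>s. f (x + s *\<^sub>R u)) has_derivative (\<lambda>s. (s *\<^sub>R u) \<bullet> g)) (at 0)"
    using has_derivative_compose by blast
  moreover have "(\<lambda>s. (s *\<^sub>R u) \<bullet> g) = (*) (u \<bullet> g)" by (auto simp: fun_eq_iff)
  ultimately show ?thesis unfolding has_dir_deriv_def has_field_derivative_def by simp
qed

text \<open>Differentiating in the direction of the gradient itself gives
  \<open>g \<bullet> g \<le> L * norm g\<close>.\<close>

lemma GDERIV_norm_le:
  fixes f :: "'a::euclidean_space \<Rightarrow> real"
  assumes "GDERIV f y :> g" and lip: "L-lipschitz_on (ball z r) f" and y: "y \<in> ball z r"
  shows "norm g \<le> L"
proof (cases "g = 0")
  case True
  then show ?thesis using lipschitz_on_nonneg[OF lip] by simp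
next
  case False
  have lim: "((\<lambda>s. (f (y + s *\<^sub>R g) - f y) / s) \<longlongrightarrow> g \<bullet> g) (at 0)"
    using GDERIV_has_dir_deriv[OF assms(1)] has_dir_deriv_iff by blast
  have "((\<lambda>s. y + s *\<^sub>R g) \<longlongrightarrow> y + 0 *\<^sub>R g) (at 0)" by (intro tendsto_intros)
  then have "\<forall>\<^sub>F s in at 0. y + s *\<^sub>R g \<in> ball z r" using y by (auto dest: topological_tendstoD[OF _ open_ball])
  moreover have "\<forall>\<^sub>F s in at (0::real). s \<noteq> 0" by (simp add: eventually_at_filter)
  ultimately have "\<forall>\<^sub>F s in at 0. (f (y + s *\<^sub>R g) - f y) / s \<le> L * norm g"
  proof eventually_elim
    case (elim s)
    have "\<bar>f (y + s *\<^sub>R g) - f y\<bar> \<le> L * (\<bar>s\<bar> * norm g)"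
      using lipschitz_onD[OF lip elim(1) y] by (simp add: dist_norm)
    then have "\<bar>(f (y + s *\<^sub>R g) - f y) / s\<bar> \<le> L * norm g"
      using elim(2) by (simp add: abs_divide field_simps)
    then show ?case by linarith
  qed
  then have "g \<bullet> g \<le> L * norm g" using tendsto_upperbound[OF lim] by simp
  then show ?thesis using False by (simp add: dot_square_norm power2_eq_square)
qed

text \<open>The limiting gradients at \<open>x\<close> are the slice over \<open>x\<close> of the
  closure of this set. Sequences thereby disappear, and compactness over a whole ball becomes
  compactness of a projection.\<close>

definition gradient_graph :: "('a::real_inner \<Rightarrow> real) \<Rightarrow> ('a \<times> 'a) set" where
  "gradient_graph f = {(x, g). GDERIV f x :> g}"

lemma limiting_gradients_eq:
  "{v. \<exists>xs g. xs \<longlonglongrightarrow> x \<and> (\<forall>r::nat. GDERIV f (xs r) :> g r) \<and> g \<longlonglongrightarrow> v} = {v. (x, v) \<in> closure (gradient_graph f)}"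
  (is "?A = ?B")
proof (intro set_eqI iffI)
  fix v assume "v \<in> ?A"
  then obtain xs g where "xs \<longlonglongrightarrow> x" "\<forall>r::nat. GDERIV f (xs r) :> g r" "g \<longlonglongrightarrow> v" by blast
  then have "(\<forall>n. (xs n, g n) \<in> gradient_graph f) \<and> (\<lambda>n. (xs n, g n)) \<longlonglongrightarrow> (x, v)"
    by (auto simp: gradient_graph_def intro: tendsto_Pair)
  then show "v \<in> ?B" unfolding closure_sequential by (auto intro!: exI[of _ "\<lambda>n. (xs n, g n)"])
next
  fix v assume "v \<in> ?B"
  then obtain p where p: "\<And>n. p n \<in> gradient_graph f" "p \<longlonglongrightarrow> (x, v)" unfolding closure_sequential by auto
  have "(\<lambda>n. fst (p n)) \<longlonglongrightarrow> x" "(\<lambda>n. snd (p n)) \<longlonglongrightarrow> v"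
    using tendsto_fst[OF p(2)] tendsto_snd[OF p(2)] by auto
  moreover have "\<forall>n. GDERIV f (fst (p n)) :> snd (p n)" using p(1) by (auto simp: gradient_graph_def case_prod_unfold)
  ultimately show "v \<in> ?A"
    by (intro CollectI exI[of _ "\<lambda>n. fst (p n)"] exI[of _ "\<lambda>n. snd (p n)"]) simp
qed

lemma closure_gradient_graph_norm_le:
  fixes f :: "'a::euclidean_space \<Rightarrow> real"
  assumes "(y, v) \<in> closure (gradient_graph f)" and lip: "L-lipschitz_on (ball z r) f" and y: "y \<in> ball z r"
  shows "norm v \<le> L"
proof -
  obtain p where p: "\<And>n. p n \<in> gradient_graph f" "p \<longlonglongrightarrow> (y, v)"
    using assms(1) unfolding closure_sequential by auto
  have 1: "(\<lambda>n. fst (p n)) \<longlonglongrightarrow> y" and 2: "(\<lambda>n. snd (p n)) \<longlonglongrightarrow> v"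
    using tendsto_fst[OF p(2)] tendsto_snd[OF p(2)] by auto
  have "\<forall>\<^sub>F n in sequentially. fst (p n) \<in> ball z r" using topological_tendstoD[OF 1 open_ball y] .
  then have "\<forall>\<^sub>F n in sequentially. norm (snd (p n)) \<le> L"
  proof eventually_elim
    case (elim n)
    have "GDERIV f (fst (p n)) :> snd (p n)" using p(1)[of n] by (auto simp: gradient_graph_def case_prod_unfold)
    then show ?case using GDERIV_norm_le[OF _ lip elim] by blast
  qed
  then show ?thesis using tendsto_upperbound[OF tendsto_norm[OF 2]] by simp
qed

lemma locally_lipschitz_obtain:
  fixes f :: "'a::euclidean_space \<Rightarrow> real"
  assumes "locally_lipschitz f"
  obtains r L where "r > 0" "L-lipschitz_on (ball x r) f"
  using assms unfolding locally_lipschitz_def by blast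

lemma compact_limiting_gradients:
  fixes f :: "'a::euclidean_space \<Rightarrow> real"
  assumes f: "locally_lipschitz f" and K: "compact K"
  shows "compact {v. \<exists>y\<in>K. (y, v) \<in> closure (gradient_graph f)}"
proof -
  have "\<exists>r L. 0 < r \<and> L-lipschitz_on (ball x r) f" for x
    using locally_lipschitz_obtain[OF f] by blast
  then obtain r L where rL: "\<And>x. 0 < r x" "\<And>x. (L x)-lipschitz_on (ball x (r x)) f" by metis
  have "K \<subseteq> (\<Union>x\<in>K. ball x (r x))" using rL(1) by force
  then obtain T where T: "T \<subseteq> K" "finite T" "K \<subseteq> (\<Union>x\<in>T. ball x (r x))"
    using compactE_image[OF K, of K "\<lambda>x. ball x (r x)"] by auto
  \<comment> \<open>The extra 0 keeps \<open>Max\<close> meaningful when the finite subcover is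
    empty.\<close>
  define C where "C = Max (insert 0 (L ` T))"
  have C: "norm v \<le> C" if "y \<in> K" "(y, v) \<in> closure (gradient_graph f)" for y v
  proof -
    obtain x where "x \<in> T" "y \<in> ball x (r x)" using T(3) \<open>y \<in> K\<close> by blast
    then have "norm v \<le> L x" using closure_gradient_graph_norm_le[OF that(2) rL(2)] by blast
    also have "\<dots> \<le> C" unfolding C_def using T(2) \<open>x \<in> T\<close> by (intro Max_ge) auto
    finally show ?thesis .
  qed
  have "{v. \<exists>y\<in>K. (y, v) \<in> closure (gradient_graph f)} = snd ` ((K \<times> cball 0 C) \<inter> closure (gradient_graph f))"
    using C by force
  moreover have "compact ((K \<times> cball 0 C) \<inter> closure (gradient_graph f))"
    by (intro compact_Int_closed compact_Times K compact_cball closed_closure)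
  ultimately show ?thesis by (auto intro!: compact_continuous_image continuous_intros)
qed

lemma clarke_eq_convex_hull:
  fixes f :: "'a::euclidean_space \<Rightarrow> real"
  assumes "locally_lipschitz f"
  shows "clarke_subdifferential f x = convex hull {v. (x, v) \<in> closure (gradient_graph f)}"
proof -
  have "compact {v. (x, v) \<in> closure (gradient_graph f)}"
    using compact_limiting_gradients[OF assms, of "{x}"] by simp
  then show ?thesis unfolding clarke_subdifferential_def limiting_gradients_eq
    by (intro closure_closed compact_imp_closed compact_convex_hull)
qed

text \<open>Forming hulls point by point before the final hull does not enlarge it. In this form the
  set is the hull of a compact set, hence compact, so that a shortest vector exists.\<close>

lemma goldstein_eq_convex_hull:
  fixes f :: "'a::euclidean_space \<Rightarrow> real"
  assumes "locally_lipschitz f"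
  shows "goldstein_subdifferential \<epsilon> f x = convex hull {v. \<exists>y\<in>cball x \<epsilon>. (y, v) \<in> closure (gradient_graph f)}"
    (is "_ = convex hull ?G")
proof
  show "goldstein_subdifferential \<epsilon> f x \<subseteq> convex hull ?G"
    unfolding goldstein_subdifferential_def clarke_eq_convex_hull[OF assms]
    by (intro hull_minimal convex_convex_hull UN_least hull_mono) blast
  show "convex hull ?G \<subseteq> goldstein_subdifferential \<epsilon> f x"
    unfolding goldstein_subdifferential_def clarke_eq_convex_hull[OF assms]
    by (intro hull_mono) (auto intro: hull_inc)
qed

text \<open>Points of differentiability accumulate at \<open>x\<close>, and their gradients are
  bounded by a local Lipschitz constant; a subsequence converges to a limiting gradient.\<close>

lemma clarke_nonempty:
  fixes f :: "'a::euclidean_space \<Rightarrow> real"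
  assumes f: "locally_lipschitz f"
  shows "clarke_subdifferential f x \<noteq> {}"
proof -
  obtain r L where r: "r > 0" and lip: "L-lipschitz_on (ball x r) f"
    using locally_lipschitz_obtain[OF f] by blast
  have "\<exists>y g. dist y x < min r (1 / Suc n) \<and> GDERIV f y :> g" for n
    using locally_lipschitz_GDERIV_dense[OF lip r, of "min r (1 / Suc n)"] r by (metis divide_pos_pos min_less_iff_conj of_nat_0_less_iff zero_less_Suc zero_less_one)
  then obtain y g where yg: "\<And>n. dist (y n) x < min r (1 / Suc n)" "\<And>n. GDERIV f (y n) :> g n" by metis
  have "norm (g n) \<le> L" for n
    using GDERIV_norm_le[OF yg(2) lip] yg(1)[of n] by (simp add: dist_commute)
  then have "\<forall>n. g n \<in> cball 0 L" by simp
  then obtain v \<phi> where "strict_mono \<phi>" and v: "(g \<circ> \<phi>) \<longlonglongrightarrow> v"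
    using compact_imp_seq_compact[OF compact_cball] unfolding seq_compact_def by metis
  have "y \<longlonglongrightarrow> x"
  proof (rule metric_LIMSEQ_I)
    fix e :: real assume "e > 0"
    then obtain N where N: "1 / Suc N < e" using nat_approx_posE by blast
    have "dist (y n) x < e" if "n \<ge> N" for n
    proof -
      have "dist (y n) x < 1 / Suc n" using yg(1)[of n] by simp
      also have "\<dots> \<le> 1 / Suc N" using that by (simp add: frac_le)
      finally show ?thesis using N by simp
    qed
    then show "\<exists>N. \<forall>n\<ge>N. dist (y n) x < e" by blast
  qed
  then have "(\<lambda>n. (y (\<phi> n), g (\<phi> n))) \<longlonglongrightarrow> (x, v)"
    using v LIMSEQ_subseq_LIMSEQ[OF _ \<open>strict_mono \<phi>\<close>, of y x] by (intro tendsto_Pair) (auto simp: o_def)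
  moreover have "(y (\<phi> n), g (\<phi> n)) \<in> gradient_graph f" for n using yg(2) by (simp add: gradient_graph_def)
  ultimately have "(x, v) \<in> closure (gradient_graph f)"
    unfolding closure_sequential by (intro exI[of _ "\<lambda>n. (y (\<phi> n), g (\<phi> n))"]) simp
  then show ?thesis unfolding clarke_eq_convex_hull[OF f] by (auto simp: convex_hull_eq_empty)
qed

lemma clarke_norm_le:
  fixes f :: "'a::euclidean_space \<Rightarrow> real"
  assumes f: "locally_lipschitz f" and lip: "L-lipschitz_on (ball z r) f" and "y \<in> ball z r"
    and "v \<in> clarke_subdifferential f y"
  shows "norm v \<le> L"
proof -
  have "convex hull {v. (y, v) \<in> closure (gradient_graph f)} \<subseteq> cball 0 L"
    using closure_gradient_graph_norm_le[OF _ lip \<open>y \<in> ball z r\<close>] by (intro hull_minimal) auto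
  then show ?thesis using assms(4) unfolding clarke_eq_convex_hull[OF f] by auto
qed

lemma convex_clarke: "locally_lipschitz f \<Longrightarrow> convex (clarke_subdifferential f x)"
  by (simp add: clarke_eq_convex_hull)

section \<open>The Goldstein subgradient and modulus\<close>

lemma goldstein_subgradient_is_min:
  fixes f :: "'a::euclidean_space \<Rightarrow> real"
  assumes f: "locally_lipschitz f" and "\<epsilon> \<ge> 0"
  shows "goldstein_subgradient \<epsilon> f x \<in> goldstein_subdifferential \<epsilon> f x"
    and "\<And>v. v \<in> goldstein_subdifferential \<epsilon> f x \<Longrightarrow> norm (goldstein_subgradient \<epsilon> f x) \<le> norm v"
proof -
  let ?G = "goldstein_subdifferential \<epsilon> f x"
  have "compact ?G"
    unfolding goldstein_eq_convex_hull[OF f]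
    by (intro compact_convex_hull compact_limiting_gradients f compact_cball)
  moreover have "clarke_subdifferential f x \<subseteq> ?G"
    unfolding goldstein_subdifferential_def using \<open>\<epsilon> \<ge> 0\<close> by (auto intro!: hull_inc bexI[of _ x])
  then have "?G \<noteq> {}" using clarke_nonempty[OF f] by blast
  moreover have "continuous_on ?G norm" by (intro continuous_intros)
  ultimately obtain v where v: "v \<in> ?G" "\<forall>w\<in>?G. norm v \<le> norm w"
    using continuous_attains_inf by blast
  then have "is_arg_min norm (\<lambda>v. v \<in> ?G) v" by (auto simp: is_arg_min_linorder)
  then have "is_arg_min norm (\<lambda>v. v \<in> ?G) (goldstein_subgradient \<epsilon> f x)"
    unfolding goldstein_subgradient_def arg_min_on_def arg_min_def by (rule someI)
  then show "goldstein_subgradient \<epsilon> f x \<in> ?G"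
    "\<And>v. v \<in> ?G \<Longrightarrow> norm (goldstein_subgradient \<epsilon> f x) \<le> norm v"
    by (auto simp: is_arg_min_linorder)
qed

text \<open>The greatest-lower-bound rule for \<open>Inf\<close> needs an admissible radius. The
  norm of any Clarke subgradient \<open>v\<close> at \<open>x\<close> is one, since \<open>v\<close>
  lies in the Goldstein subdifferential of that radius.\<close>

lemma goldstein_modulus_ge:
  fixes f :: "'a::euclidean_space \<Rightarrow> real"
  assumes f: "locally_lipschitz f"
    and large: "\<And>\<epsilon> g. \<lbrakk>0 \<le> \<epsilon>; \<epsilon> < a; g \<in> goldstein_subdifferential \<epsilon> f x\<rbrakk> \<Longrightarrow> a \<le> norm g"
  shows "a \<le> goldstein_modulus f x"
  unfolding goldstein_modulus_def
proof (rule cInf_greatest)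
  obtain v where v: "v \<in> clarke_subdifferential f x" using clarke_nonempty[OF f] by blast
  then have "v \<in> goldstein_subdifferential (norm v) f x"
    unfolding goldstein_subdifferential_def by (intro hull_inc) auto
  then have "norm (goldstein_subgradient (norm v) f x) \<le> norm v"
    using goldstein_subgradient_is_min(2)[OF f] by simp
  then show "{\<epsilon>. 0 \<le> \<epsilon> \<and> norm (goldstein_subgradient \<epsilon> f x) \<le> \<epsilon>} \<noteq> {}"
    by (auto intro!: exI[of _ "norm v"])
next
  fix \<epsilon> assume "\<epsilon> \<in> {\<epsilon>. 0 \<le> \<epsilon> \<and> norm (goldstein_subgradient \<epsilon> f x) \<le> \<epsilon>}"
  then show "a \<le> \<epsilon>"
    using large goldstein_subgradient_is_min(1)[OF f] by fastforce
qed

section \<open>Derivatives, regularity and quadratic growth\<close>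

lemma has_derivative_eventually_norm_le:
  fixes f :: "'a::real_normed_vector \<Rightarrow> 'b::real_normed_vector"
  assumes "(f has_derivative D) (at x)" and "e > 0"
  shows "\<forall>\<^sub>F y in nhds x. norm (f y - f x - D (y - x)) \<le> e * norm (y - x)"
  using assms unfolding has_derivative_at_alt eventually_nhds_metric by (auto simp: dist_norm)

lemma has_derivative_eventually_lipschitz:
  fixes f :: "'a::real_normed_vector \<Rightarrow> 'b::real_normed_vector"
  assumes "(f has_derivative D) (at x)"
  obtains C where "C > 0" "\<forall>\<^sub>F y in nhds x. norm (f y - f x) \<le> C * norm (y - x)"
proof -
  obtain K where K: "\<And>h. norm (D h) \<le> norm h * K" "K > 0"
    using bounded_linear.pos_bounded[OF has_derivative_bounded_linear[OF assms]] by blast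
  have "\<forall>\<^sub>F y in nhds x. norm (f y - f x) \<le> (K + 1) * norm (y - x)"
    using has_derivative_eventually_norm_le[OF assms zero_less_one]
  proof eventually_elim
    case (elim y)
    have "norm (f y - f x) \<le> norm (f y - f x - D (y - x)) + norm (D (y - x))"
      by (metis diff_add_cancel norm_triangle_ineq)
    then show ?case using elim K(1)[of "y - x"] by (simp add: algebra_simps)
  qed
  then show ?thesis using K(2) by (intro that[of "K + 1"]) auto
qed

text \<open>Along the segment from \<open>w\<close> to \<open>z\<close> the derivative of \<open>h\<close> is \<open>t H(d, d)\<close> up to a small error,
  where \<open>d = z - w\<close>; the mean value theorem and the quadratic growth force \<open>H(d, d)\<close> to be
  positive.\<close>

lemma radial_derivative_ge:
  fixes h :: "'a::real_normed_vector \<Rightarrow> real" and h' :: "'a \<Rightarrow> 'a \<Rightarrow>\<^sub>L real"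
  assumes V: "open V" "w \<in> V"
    and h': "\<And>z. z \<in> V \<Longrightarrow> (h has_derivative blinfun_apply (h' z)) (at z)"
    and h'': "(h' has_derivative H) (at w)"
    and S: "subspace S" and "c > 0"
    and growth: "\<forall>\<^sub>F z in nhds w. z - w \<in> S \<longrightarrow> c * (norm (z - w))\<^sup>2 \<le> h z - h w"
  shows "\<forall>\<^sub>F z in nhds w. z - w \<in> S \<longrightarrow> c / 2 * (norm (z - w))\<^sup>2 \<le> h' z (z - w)"
proof -
  have "\<forall>\<^sub>F z in nhds w. z \<in> V \<and> (z - w \<in> S \<longrightarrow> c * (norm (z - w))\<^sup>2 \<le> h z - h w) \<and>
      norm (h' z - h' w - H (z - w)) \<le> c / 4 * norm (z - w)"
    \<comment> \<open>The error \<open>c / 4\<close> is spent twice: once at the mean value point,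
      leaving \<open>3 / 4 * c\<close>, and once at \<open>z\<close>, leaving the claimed
      \<open>c / 2\<close>.\<close>
    using V growth \<open>c > 0\<close> by (intro eventually_conj eventually_nhds_in_open has_derivative_eventually_norm_le[OF h'']) auto
  then obtain r where "r > 0" and r: "\<And>z. dist z w < r \<Longrightarrow> z \<in> V"
    "\<And>z. dist z w < r \<Longrightarrow> z - w \<in> S \<Longrightarrow> c * (norm (z - w))\<^sup>2 \<le> h z - h w"
    "\<And>z. dist z w < r \<Longrightarrow> norm (h' z - h' w - H (z - w)) \<le> c / 4 * norm (z - w)"
    unfolding eventually_nhds_metric by blast
  have "c / 2 * (norm (z - w))\<^sup>2 \<le> h' z (z - w)" if z: "dist z w < r" "z - w \<in> S" for z
  proof (cases "z = w")
    case True
    then show ?thesis by simp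
  next
    case False
    define d where "d = z - w"
    have d: "norm d < r" "d \<in> S" "d \<noteq> 0" using z False by (auto simp: d_def dist_norm)
    have seg: "dist (w + t *\<^sub>R d) w < r" if "\<bar>t\<bar> \<le> 1" for t
    proof -
      have "\<bar>t\<bar> * norm d \<le> 1 * norm d" using that by (intro mult_right_mono) auto
      then show ?thesis using d(1) by (simp add: dist_norm)
    qed
    define k where "k t = h (w + t *\<^sub>R d)" for t
    have k': "(k has_real_derivative h' (w + t *\<^sub>R d) d) (at t)" if "\<bar>t\<bar> \<le> 1" for t
    proof -
      have "((\<lambda>t. w + t *\<^sub>R d) has_derivative (\<lambda>s. s *\<^sub>R d)) (at t)"
        by (auto intro!: derivative_eq_intros)
      from has_derivative_compose[OF this h'[OF r(1)[OF seg[OF that]]]]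
      show ?thesis unfolding k_def has_field_derivative_def
        by (rule has_derivative_eq_rhs) (auto simp: blinfun.scaleR_right fun_eq_iff)
    qed
    \<comment> \<open>Since \<open>S\<close> contains both \<open>d\<close> and \<open>- d\<close>,
      growth holds on either side of \<open>w\<close>, and \<open>t = 0\<close> is an interior
      minimum of \<open>k\<close>.\<close>
    have "h' (w + 0 *\<^sub>R d) d = 0"
    proof (rule DERIV_local_min[OF k'[of 0]])
      show "\<forall>y. \<bar>0 - y\<bar> < 1 \<longrightarrow> k 0 \<le> k y"
      proof (intro allI impI)
        fix y :: real assume "\<bar>0 - y\<bar> < 1"
        then have "c * (norm (y *\<^sub>R d))\<^sup>2 \<le> h (w + y *\<^sub>R d) - h w"
          using r(2)[OF seg[of y]] subspace_scale[OF S d(2)] by simp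
        moreover have "0 \<le> c * (norm (y *\<^sub>R d))\<^sup>2" using \<open>c > 0\<close> by simp
        ultimately show "k 0 \<le> k y" by (simp add: k_def)
      qed
    qed auto
    then have a0: "h' w d = 0" by simp
    have lin: "H (t *\<^sub>R d) = t *\<^sub>R H d" for t
      using has_derivative_linear[OF h''] by (simp add: linear_scale)
    have err: "\<bar>h' (w + t *\<^sub>R d) d - t * H d d\<bar> \<le> c / 4 * (norm d)\<^sup>2" if t: "0 \<le> t" "t \<le> 1" for t
    proof -
      have "h' (w + t *\<^sub>R d) d - t * H d d = (h' (w + t *\<^sub>R d) - h' w - H (t *\<^sub>R d)) d"
        by (simp add: lin a0 blinfun.diff_left blinfun.scaleR_left)
      then have "\<bar>h' (w + t *\<^sub>R d) d - t * H d d\<bar> \<le> norm (h' (w + t *\<^sub>R d) - h' w - H (t *\<^sub>R d)) * norm d"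
        by (metis norm_blinfun real_norm_def)
      also have "\<dots> \<le> (c / 4 * norm (t *\<^sub>R d)) * norm d"
        using r(3)[OF seg[of t]] t by (intro mult_right_mono) auto
      also have "\<dots> = t * (c / 4 * (norm d)\<^sup>2)" using t by (simp add: power2_eq_square)
      also have "\<dots> \<le> 1 * (c / 4 * (norm d)\<^sup>2)" using t \<open>c > 0\<close> by (intro mult_right_mono) auto
      finally show ?thesis by simp
    qed
    obtain t where t: "0 < t" "t < 1" and mvt: "k 1 - k 0 = (1 - 0) * h' (w + t *\<^sub>R d) d"
      using MVT2[of 0 1 k "\<lambda>t. h' (w + t *\<^sub>R d) d"] k' by force
    have "c * (norm d)\<^sup>2 \<le> h' (w + t *\<^sub>R d) d"
      using mvt r(2)[of z] z by (simp add: k_def d_def)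
    moreover have "\<bar>h' (w + t *\<^sub>R d) d - t * H d d\<bar> \<le> c * (norm d)\<^sup>2 / 4" using err[of t] t by simp
    ultimately have 1: "3 / 4 * (c * (norm d)\<^sup>2) \<le> t * H d d" by linarith
    have "0 < 3 / 4 * (c * (norm d)\<^sup>2)" using \<open>c > 0\<close> d(3) by simp
    then have "0 < t * H d d" using 1 by linarith
    then have "0 < H d d" using t by (simp add: zero_less_mult_iff)
    then have "t * H d d \<le> 1 * H d d" using t by (intro mult_right_mono) auto
    then have "3 / 4 * (c * (norm d)\<^sup>2) \<le> H d d" using 1 by linarith
    moreover have "w + d = z" by (simp add: d_def)
    then have "\<bar>h' z d - H d d\<bar> \<le> c * (norm d)\<^sup>2 / 4" using err[of 1] by simp
    ultimately show ?thesis unfolding d_def[symmetric] by linarith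
  qed
  then show ?thesis unfolding eventually_nhds_metric using \<open>r > 0\<close> by blast
qed

text \<open>Regularity speaks of straight rays, whereas motion within \<open>M\<close> is curved.
  Lipschitz continuity makes the quotients along a curve and along its tangent ray differ by at most
  \<open>L\<close> times the tangency error, so both have the limit \<open>D\<close>.\<close>

lemma regular_subgradient_le_curve_derivative:
  fixes f :: "'a::euclidean_space \<Rightarrow> real"
  assumes f: "locally_lipschitz f" and reg: "subdifferentially_regular f p"
    and \<gamma>: "((\<lambda>t. (\<gamma> t - p) /\<^sub>R t) \<longlongrightarrow> w) (at_right 0)"
    and D: "((\<lambda>t. (f (\<gamma> t) - f p) / t) \<longlongrightarrow> D) (at_right 0)"
    and v: "v \<in> clarke_subdifferential f p"
  shows "v \<bullet> w \<le> D"
proof -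
  obtain r L where r: "r > 0" and lip: "L-lipschitz_on (ball p r) f"
    using locally_lipschitz_obtain[OF f] by blast
  have L0: "L \<ge> 0" using lipschitz_on_nonneg[OF lip] .
  have t0: "\<forall>\<^sub>F t in at_right 0. (0::real) < t" by (simp add: eventually_at_right_less)
  have id0: "((\<lambda>t. t) \<longlongrightarrow> 0) (at_right (0::real))" by (rule tendsto_ident_at)
  have "((\<lambda>t. p + t *\<^sub>R ((\<gamma> t - p) /\<^sub>R t)) \<longlongrightarrow> p + 0 *\<^sub>R w) (at_right 0)"
    by (intro tendsto_intros id0 \<gamma>)
  from topological_tendstoD[OF this open_ball[of p r]]
  have b1: "\<forall>\<^sub>F t in at_right 0. p + t *\<^sub>R ((\<gamma> t - p) /\<^sub>R t) \<in> ball p r"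
    using r by simp
  have "((\<lambda>t. p + t *\<^sub>R w) \<longlongrightarrow> p + 0 *\<^sub>R w) (at_right 0)" by (intro tendsto_intros id0)
  from topological_tendstoD[OF this open_ball[of p r]]
  have b2: "\<forall>\<^sub>F t in at_right 0. p + t *\<^sub>R w \<in> ball p r"
    using r by simp
  have "((\<lambda>t. L * norm ((\<gamma> t - p) /\<^sub>R t - w)) \<longlongrightarrow> L * norm (w - w)) (at_right 0)"
    by (intro tendsto_intros \<gamma>)
  then have lim0: "((\<lambda>t. L * norm ((\<gamma> t - p) /\<^sub>R t - w)) \<longlongrightarrow> 0) (at_right 0)" by simp
  have "((\<lambda>t. (f (p + t *\<^sub>R w) - f p) / t - (f (\<gamma> t) - f p) / t) \<longlongrightarrow> 0) (at_right 0)"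
  proof (rule Lim_null_comparison[OF _ lim0])
    show "\<forall>\<^sub>F t in at_right 0. norm ((f (p + t *\<^sub>R w) - f p) / t - (f (\<gamma> t) - f p) / t)
        \<le> L * norm ((\<gamma> t - p) /\<^sub>R t - w)"
      using t0 b1 b2
    proof eventually_elim
      case (elim t)
      define u where "u = (\<gamma> t - p) /\<^sub>R t"
      have \<gamma>t: "\<gamma> t = p + t *\<^sub>R u" using elim(1) by (simp add: u_def)
      have "\<bar>f (p + t *\<^sub>R w) - f (p + t *\<^sub>R u)\<bar> \<le> L * norm (t *\<^sub>R (w - u))"
        using lipschitz_onD[OF lip elim(3) elim(2)[folded u_def]] by (simp add: dist_norm algebra_simps)
      also have "\<dots> = t * (L * norm (u - w))" using elim(1) by (simp add: norm_minus_commute)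
      finally have "\<bar>f (p + t *\<^sub>R w) - f (\<gamma> t)\<bar> / t \<le> L * norm (u - w)"
        using elim(1) \<gamma>t by (simp add: pos_divide_le_eq mult.commute)
      then show ?case using elim(1) by (simp add: u_def diff_divide_distrib[symmetric])
    qed
  qed
  from tendsto_add[OF this D] have "((\<lambda>t. (f (p + t *\<^sub>R w) - f p) / t) \<longlongrightarrow> D) (at_right 0)" by simp
  moreover have "((\<lambda>t. (f (p + t *\<^sub>R w) - f p) / t) \<longlongrightarrow> (SUP v\<in>clarke_subdifferential f p. v \<bullet> w)) (at_right 0)"
    using reg unfolding subdifferentially_regular_def by blast
  ultimately have "(SUP v\<in>clarke_subdifferential f p. v \<bullet> w) = D"
    using tendsto_unique[OF trivial_limit_at_right_real] by blast
  moreover have "v \<bullet> w \<le> (SUP v\<in>clarke_subdifferential f p. v \<bullet> w)"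
  proof (rule cSUP_upper[OF v])
    have "u \<bullet> w \<le> L * norm w" if "u \<in> clarke_subdifferential f p" for u
    proof -
      have "norm u \<le> L" using clarke_norm_le[OF f lip _ that] r by simp
      then show ?thesis using norm_cauchy_schwarz[of u w] mult_right_mono[of "norm u" L "norm w"] by simp
    qed
    then show "bdd_above ((\<lambda>v. v \<bullet> w) ` clarke_subdifferential f p)" by (rule bdd_aboveI2)
  qed
  ultimately show ?thesis by simp
qed

section \<open>Charts, tangent space and projection\<close>

text \<open>The second derivative is extracted for \<open>\<psi>\<close>, because \<open>f\<close>
  is pulled back along \<open>\<psi>\<close> and the derivative of the pullback is differentiated
  once more.\<close>

lemma C2_manifold_chart:
  fixes M :: "'a::euclidean_space set"
  assumes "C2_manifold_around M xbar"
  obtains U V S :: "'a set" and \<phi> \<psi> :: "'a \<Rightarrow> 'a" and \<phi>' \<psi>' :: "'a \<Rightarrow> 'a \<Rightarrow>\<^sub>L 'a"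
    and \<psi>'' :: "'a \<Rightarrow> 'a \<Rightarrow> 'a \<Rightarrow>\<^sub>L 'a"
  where "open U" "xbar \<in> U" "open V" "homeomorphism U V \<phi> \<psi>" "subspace S" "\<phi> ` (M \<inter> U) = S \<inter> V" "xbar \<in> M"
    "\<And>x. x \<in> U \<Longrightarrow> (\<phi> has_derivative \<phi>' x) (at x)"
    "\<And>z. z \<in> V \<Longrightarrow> (\<psi> has_derivative \<psi>' z) (at z)"
    "\<And>z. z \<in> V \<Longrightarrow> (\<psi>' has_derivative \<psi>'' z) (at z)"
proof -
  obtain U V :: "'a set" and \<phi> \<psi> and S :: "'a set" where *: "open U \<and> open V \<and> xbar \<in> U \<and> homeomorphism U V \<phi> \<psi> \<and>
      C2_on U \<phi> \<and> C2_on V \<psi> \<and> subspace S \<and> \<phi> ` (M \<inter> U) = S \<inter> V"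
    using conjunct2[OF assms[unfolded C2_manifold_around_def]] by (elim exE) (rule that)
  then have "C2_on V \<psi>" by blast
  obtain \<phi>' :: "'a \<Rightarrow> 'a \<Rightarrow>\<^sub>L 'a" where "\<And>x. x \<in> U \<Longrightarrow> (\<phi> has_derivative \<phi>' x) (at x)"
    using * unfolding C2_on_def by metis
  moreover obtain \<psi>' :: "'a \<Rightarrow> 'a \<Rightarrow>\<^sub>L 'a" and \<psi>'' :: "'a \<Rightarrow> 'a \<Rightarrow>\<^sub>L ('a \<Rightarrow>\<^sub>L 'a)"
    where "\<forall>z\<in>V. (\<psi> has_derivative \<psi>' z) (at z)" "\<forall>z\<in>V. (\<psi>' has_derivative \<psi>'' z) (at z)"
    using \<open>C2_on V \<psi>\<close>[unfolded C2_on_def] by (elim exE conjE) (rule that)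
  moreover have "xbar \<in> M" using assms by (simp add: C2_manifold_around_def)
  ultimately show ?thesis using * by (intro that[of U V \<phi> \<psi> S \<phi>' \<psi>' "\<lambda>z. blinfun_apply (\<psi>'' z)"]) auto
qed

lemma C2_manifold_tangent_space:
  fixes M :: "'a::euclidean_space set"
  assumes "C2_manifold_around M xbar"
  obtains T where "subspace T"
    "\<And>\<eta>. \<eta> > 0 \<Longrightarrow> \<forall>\<^sub>F p in nhds xbar. p \<in> M \<longrightarrow> (\<exists>t\<in>T. norm (p - xbar - t) \<le> \<eta> * norm (p - xbar))"
    "\<And>\<eta>. \<eta> > 0 \<Longrightarrow> \<forall>\<^sub>F t in nhds 0. t \<in> T \<longrightarrow> (\<exists>q\<in>M. norm (q - xbar - t) \<le> \<eta> * norm t)"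
proof -
  obtain U V S :: "'a set" and \<phi> \<psi> :: "'a \<Rightarrow> 'a" and \<phi>' \<psi>' :: "'a \<Rightarrow> 'a \<Rightarrow>\<^sub>L 'a"
    and \<psi>'' :: "'a \<Rightarrow> 'a \<Rightarrow> 'a \<Rightarrow>\<^sub>L 'a"
    where U: "open U" "xbar \<in> U" and V: "open V" and hom: "homeomorphism U V \<phi> \<psi>"
    and S: "subspace S" and M: "\<phi> ` (M \<inter> U) = S \<inter> V" and "xbar \<in> M"
    and \<phi>': "\<And>x. x \<in> U \<Longrightarrow> (\<phi> has_derivative \<phi>' x) (at x)"
    and \<psi>': "\<And>z. z \<in> V \<Longrightarrow> (\<psi> has_derivative \<psi>' z) (at z)"
    and "\<And>z. z \<in> V \<Longrightarrow> (\<psi>' has_derivative \<psi>'' z) (at z)"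
    by (rule C2_manifold_chart[OF assms]) (rule that)
  define w where "w = \<phi> xbar"
  have w: "w \<in> S" "w \<in> V" using M U \<open>xbar \<in> M\<close> by (auto simp: w_def)
  have \<psi>w: "\<psi> w = xbar" using hom U by (auto simp: w_def homeomorphism_def)
  define T where "T = \<psi>' w ` S"
  \<comment> \<open>By the chain rule \<open>\<phi>' xbar\<close> recovers the flat coordinate
    \<open>d\<close> of a tangent vector, which later selects the point of \<open>M\<close> above
    it.\<close>
  have comp: "\<phi>' xbar (\<psi>' w d) = d" for d
  proof -
    have "((\<phi> \<circ> \<psi>) has_derivative (\<phi>' xbar \<circ> \<psi>' w)) (at w)"
      using diff_chain_at[OF \<psi>'[OF w(2)]] \<phi>'[OF U(2)] \<psi>w by simp
    moreover have "((\<phi> \<circ> \<psi>) has_derivative (\<lambda>x. x)) (at w)"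
      by (rule has_derivative_transform_within_open[OF has_derivative_ident V w(2)])
        (use hom in \<open>auto simp: homeomorphism_def\<close>)
    ultimately have "\<phi>' xbar \<circ> \<psi>' w = (\<lambda>x. x)" by (rule has_derivative_unique)
    then show ?thesis by (metis comp_apply)
  qed
  show ?thesis
  proof
    show "subspace T" unfolding T_def
      by (intro linear_subspace_image S blinfun.bounded_linear_right bounded_linear.linear)
  next
    fix \<eta> :: real assume "\<eta> > 0"
    obtain C where "C > 0" and C: "\<forall>\<^sub>F p in nhds xbar. norm (\<phi> p - \<phi> xbar) \<le> C * norm (p - xbar)"
      using has_derivative_eventually_lipschitz[OF \<phi>'[OF U(2)]] by blast
    have lim: "filterlim \<phi> (nhds w) (nhds xbar)"
      using has_derivative_continuous[OF \<phi>'[OF U(2)]] unfolding w_def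
      by (simp add: isCont_def tendsto_at_iff_tendsto_nhds)
    have "\<forall>\<^sub>F z in nhds w. norm (\<psi> z - \<psi> w - \<psi>' w (z - w)) \<le> \<eta> / C * norm (z - w)"
      by (rule has_derivative_eventually_norm_le[OF \<psi>'[OF w(2)]]) (simp add: \<open>\<eta> > 0\<close> \<open>C > 0\<close>)
    then have "\<forall>\<^sub>F p in nhds xbar. norm (\<psi> (\<phi> p) - \<psi> w - \<psi>' w (\<phi> p - w)) \<le> \<eta> / C * norm (\<phi> p - w)"
      using lim by (rule eventually_compose_filterlim)
    with C eventually_nhds_in_open[OF U]
    show "\<forall>\<^sub>F p in nhds xbar. p \<in> M \<longrightarrow> (\<exists>t\<in>T. norm (p - xbar - t) \<le> \<eta> * norm (p - xbar))"
    proof eventually_elim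
      case (elim p)
      show ?case
      proof (intro impI bexI[of _ "\<psi>' w (\<phi> p - w)"])
        assume "p \<in> M"
        then have "\<phi> p \<in> S" using M elim(2) by blast
        then show "\<psi>' w (\<phi> p - w) \<in> T" unfolding T_def using S w(1) by (auto intro: subspace_diff)
        have "\<psi> (\<phi> p) = p" using hom elim(2) by (auto simp: homeomorphism_def)
        then have "norm (p - xbar - \<psi>' w (\<phi> p - w)) \<le> \<eta> / C * norm (\<phi> p - w)" using elim(3) \<psi>w by simp
        also have "\<dots> \<le> \<eta> / C * (C * norm (p - xbar))"
          using elim(1) \<open>\<eta> > 0\<close> \<open>C > 0\<close> by (intro mult_left_mono) (auto simp: w_def)
        finally show "norm (p - xbar - \<psi>' w (\<phi> p - w)) \<le> \<eta> * norm (p - xbar)" using \<open>C > 0\<close> by simp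
      qed
    qed
  next
    fix \<eta> :: real assume "\<eta> > 0"
    obtain C where "C > 0" and C: "\<And>h. norm (\<phi>' xbar h) \<le> norm h * C"
      using bounded_linear.pos_bounded[OF blinfun.bounded_linear_right[of "\<phi>' xbar"]] by blast
    have "((\<lambda>t. w + \<phi>' xbar t) \<longlongrightarrow> w + \<phi>' xbar 0) (nhds 0)"
      by (intro tendsto_intros filterlim_ident)
    then have lim: "filterlim (\<lambda>t. w + \<phi>' xbar t) (nhds w) (nhds 0)" by (simp add: blinfun.zero_right)
    have "\<forall>\<^sub>F z in nhds w. z \<in> V \<and> norm (\<psi> z - \<psi> w - \<psi>' w (z - w)) \<le> \<eta> / C * norm (z - w)"
      by (intro eventually_conj eventually_nhds_in_open V w(2) has_derivative_eventually_norm_le[OF \<psi>'[OF w(2)]])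
        (simp add: \<open>\<eta> > 0\<close> \<open>C > 0\<close>)
    then have "\<forall>\<^sub>F t in nhds 0. w + \<phi>' xbar t \<in> V \<and>
        norm (\<psi> (w + \<phi>' xbar t) - \<psi> w - \<psi>' w (w + \<phi>' xbar t - w)) \<le> \<eta> / C * norm (w + \<phi>' xbar t - w)"
      using lim by (rule eventually_compose_filterlim)
    then show "\<forall>\<^sub>F t in nhds 0. t \<in> T \<longrightarrow> (\<exists>q\<in>M. norm (q - xbar - t) \<le> \<eta> * norm t)"
    proof eventually_elim
      case (elim t)
      show ?case
      \<comment> \<open>The witness moves by \<open>d\<close> within the flat space \<open>S\<close>
        and returns through the chart, so it stays in \<open>M\<close>.\<close>
      proof (intro impI bexI[of _ "\<psi> (w + \<phi>' xbar t)"])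
        assume "t \<in> T"
        then obtain d where d: "d \<in> S" "t = \<psi>' w d" unfolding T_def by blast
        have \<phi>t: "\<phi>' xbar t = d" using comp d by simp
        have "w + d \<in> S \<inter> V" using elim \<phi>t S w d by (auto intro: subspace_add)
        then obtain q where "q \<in> M \<inter> U" "\<phi> q = w + d" using M by (metis imageE)
        then show "\<psi> (w + \<phi>' xbar t) \<in> M" using hom \<phi>t by (auto simp: homeomorphism_def)
        have "norm (\<psi> (w + \<phi>' xbar t) - xbar - t) \<le> \<eta> / C * norm (\<phi>' xbar t)"
          using elim \<psi>w \<phi>t d by simp
        also have "\<dots> \<le> \<eta> / C * (norm t * C)"
          using C \<open>\<eta> > 0\<close> \<open>C > 0\<close> by (intro mult_left_mono) auto
        finally show "norm (\<psi> (w + \<phi>' xbar t) - xbar - t) \<le> \<eta> * norm t" using \<open>C > 0\<close> by simp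
      qed
    qed
  qed
qed

text \<open>The set \<open>M\<close> is controlled only near \<open>xbar\<close>: inside a closed
  ball in the chart domain it is the preimage of the closed subspace \<open>S\<close>, hence
  compact. For \<open>y\<close> within half the radius, \<open>xbar\<close> beats every point
  outside that ball, so the local minimizer is global.\<close>

lemma C2_manifold_closest_point_exists:
  fixes M :: "'a::euclidean_space set"
  assumes "C2_manifold_around M xbar"
  shows "\<forall>\<^sub>F y in nhds xbar. closest_point M y \<in> M \<and> (\<forall>q\<in>M. dist y (closest_point M y) \<le> dist y q)"
proof -
  obtain U V S :: "'a set" and \<phi> \<psi> :: "'a \<Rightarrow> 'a" and \<phi>' \<psi>' :: "'a \<Rightarrow> 'a \<Rightarrow>\<^sub>L 'a"
    and \<psi>'' :: "'a \<Rightarrow> 'a \<Rightarrow> 'a \<Rightarrow>\<^sub>L 'a"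
    where U: "open U" "xbar \<in> U" and V: "open V" and hom: "homeomorphism U V \<phi> \<psi>"
    and S: "subspace S" and M: "\<phi> ` (M \<inter> U) = S \<inter> V" and "xbar \<in> M"
    and "\<And>x. x \<in> U \<Longrightarrow> (\<phi> has_derivative \<phi>' x) (at x)"
    and "\<And>z. z \<in> V \<Longrightarrow> (\<psi> has_derivative \<psi>' z) (at z)"
    and "\<And>z. z \<in> V \<Longrightarrow> (\<psi>' has_derivative \<psi>'' z) (at z)"
    by (rule C2_manifold_chart[OF assms]) (rule that)
  obtain r where "r > 0" and r: "cball xbar r \<subseteq> U" using U open_contains_cball by blast
  have "M \<inter> cball xbar r = {x \<in> cball xbar r. \<phi> x \<in> S}"
  proof (intro set_eqI iffI)
    fix x assume "x \<in> M \<inter> cball xbar r"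
    then show "x \<in> {x \<in> cball xbar r. \<phi> x \<in> S}" using M r by blast
  next
    fix x assume x: "x \<in> {x \<in> cball xbar r. \<phi> x \<in> S}"
    then have "x \<in> U" using r by blast
    then have "\<phi> x \<in> S \<inter> V" using x hom by (auto simp: homeomorphism_def)
    then obtain q where "q \<in> M \<inter> U" "\<phi> q = \<phi> x" using M by (metis imageE)
    then have "q = x" using hom \<open>x \<in> U\<close> by (auto simp: homeomorphism_def) (metis)
    then show "x \<in> M \<inter> cball xbar r" using x \<open>q \<in> M \<inter> U\<close> by blast
  qed
  moreover have "closed {x \<in> cball xbar r. \<phi> x \<in> S}"
    using continuous_closed_preimage[of "cball xbar r" \<phi> S] hom r closed_subspace[OF S]
    by (auto simp: homeomorphism_def vimage_def Int_def intro: continuous_on_subset)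
  ultimately have comp: "compact (M \<inter> cball xbar r)"
    by (metis bounded_cball bounded_subset compact_eq_bounded_closed inf_le2)
  have "closest_point M y \<in> M \<and> (\<forall>q\<in>M. dist y (closest_point M y) \<le> dist y q)"
    if y: "dist y xbar < r / 2" for y
  proof -
    have "xbar \<in> M \<inter> cball xbar r" using \<open>xbar \<in> M\<close> \<open>r > 0\<close> by simp
    then obtain p where p: "p \<in> M \<inter> cball xbar r" "\<And>q. q \<in> M \<inter> cball xbar r \<Longrightarrow> dist y p \<le> dist y q"
      using continuous_attains_inf[OF comp _ continuous_on_dist[OF continuous_on_const continuous_on_id], of y] by blast
    have "dist y p \<le> dist y q" if "q \<in> M" for q
    proof (cases "q \<in> cball xbar r")
      case False
      have "dist xbar q \<le> dist y xbar + dist y q" by (metis dist_commute dist_triangle)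
      then have "dist y xbar \<le> dist y q" using False y by simp
      moreover have "dist y p \<le> dist y xbar" using p(2) \<open>xbar \<in> M\<close> \<open>r > 0\<close> by simp
      ultimately show ?thesis by simp
    qed (use p(2) that in blast)
    then have "p \<in> M \<and> (\<forall>q\<in>M. dist y p \<le> dist y q)" using p(1) by blast
    then show ?thesis unfolding closest_point_def by (rule someI)
  qed
  then show ?thesis unfolding eventually_nhds_metric using \<open>r > 0\<close> by (intro exI[of _ "r / 2"]) auto
qed

text \<open>Let \<open>n\<close> and \<open>s\<close> be the normal and tangential parts of
  \<open>y - xbar\<close>. A point of \<open>M\<close> close to \<open>xbar + s\<close> shows that
  the distance from \<open>y\<close> to \<open>p\<close> is barely above \<open>norm n\<close>. As
  \<open>p\<close> is itself nearly \<open>xbar + t\<close> with \<open>t\<close> tangent, the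
  Pythagorean theorem forces \<open>s - t\<close> to be small.\<close>

lemma closest_point_normal_approx:
  fixes M :: "'a::euclidean_space set"
  assumes "C2_manifold_around M xbar"
  obtains N :: "'a \<Rightarrow> 'a" where "\<And>a. norm (N a) \<le> norm a" "\<And>a b. norm (N a - N b) \<le> norm (a - b)"
    "\<And>e. e > 0 \<Longrightarrow> \<forall>\<^sub>F y in nhds xbar. norm (y - closest_point M y - N (y - xbar)) \<le> e * norm (y - xbar)"
proof -
  have "xbar \<in> M" using assms by (simp add: C2_manifold_around_def)
  obtain T where T: "subspace T"
    and T1: "\<And>\<eta>. \<eta> > 0 \<Longrightarrow> \<forall>\<^sub>F p in nhds xbar. p \<in> M \<longrightarrow> (\<exists>t\<in>T. norm (p - xbar - t) \<le> \<eta> * norm (p - xbar))"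
    and T2: "\<And>\<eta>. \<eta> > 0 \<Longrightarrow> \<forall>\<^sub>F t in nhds 0. t \<in> T \<longrightarrow> (\<exists>q\<in>M. norm (q - xbar - t) \<le> \<eta> * norm t)"
    using C2_manifold_tangent_space[OF assms] by blast
  have "\<exists>n. a - n \<in> T \<and> (\<forall>t\<in>T. n \<bullet> t = 0)" for a
  proof -
    obtain y z where "y \<in> span T" "\<And>w. w \<in> span T \<Longrightarrow> orthogonal z w" "a = y + z"
      using orthogonal_subspace_decomp_exists[of T a] by blast
    moreover have "span T = T" using T by (simp only: span_eq_iff)
    ultimately show ?thesis by (intro exI[of _ z]) (auto simp: orthogonal_def)
  qed
  then obtain N where N: "\<And>a. a - N a \<in> T" "\<And>a t. t \<in> T \<Longrightarrow> N a \<bullet> t = 0" by metis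
  have pyth: "(norm (t + n))\<^sup>2 = (norm t)\<^sup>2 + (norm n)\<^sup>2" if "n \<bullet> t = 0" for t n :: 'a
    using that norm_add_Pythagorean[of t n] by (simp add: orthogonal_def inner_commute)
  have lip: "norm (N a - N b) \<le> norm (a - b)" for a b
  proof -
    let ?t = "(a - N a) - (b - N b)" and ?n = "N a - N b"
    have t: "?t \<in> T" using T N(1) subspace_diff by blast
    have "?n \<bullet> ?t = 0" using N(2)[OF t] by (simp only: inner_diff_left)
    from pyth[OF this] have "(norm ?n)\<^sup>2 \<le> (norm (a - b))\<^sup>2" by (simp add: algebra_simps)
    then show ?thesis by (rule power2_le_imp_le) simp
  qed
  have N0: "N 0 = 0" using N(2)[of "0 - N 0" 0] N(1)[of 0] by simp
  have tle: "norm (a - N a) \<le> norm a" for a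
  proof -
    have "(norm a)\<^sup>2 = (norm (a - N a))\<^sup>2 + (norm (N a))\<^sup>2"
      using pyth[of "N a" "a - N a"] N by simp
    then have "(norm (a - N a))\<^sup>2 \<le> (norm a)\<^sup>2" by simp
    then show ?thesis by (rule power2_le_imp_le) simp
  qed
  show ?thesis
  proof
    show "norm (N a) \<le> norm a" for a using lip[of a 0] N0 by simp
    show "norm (N a - N b) \<le> norm (a - b)" for a b by (rule lip)
    fix e0 :: real assume "e0 > 0"
    define e where "e = min e0 1"
    have e: "0 < e" "e \<le> 1" "e \<le> e0" using \<open>e0 > 0\<close> by (auto simp: e_def)
    \<comment> \<open>Pythagoras bounds the square of \<open>norm (s - t)\<close> by
      \<open>15 * \<eta> * r\<^sup>2\<close>, so tangency must be quadratically better than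
      \<open>e\<close>; \<open>15 / 64 \<le> 1 / 4\<close> yields the share
      \<open>e / 2\<close>.\<close>
    define \<eta> where "\<eta> = e\<^sup>2 / 64"
    have \<eta>: "\<eta> > 0" using e by (simp add: \<eta>_def)
    obtain d1 where "d1 > 0" and d1: "\<And>p. dist p xbar < d1 \<Longrightarrow> p \<in> M \<Longrightarrow> \<exists>t\<in>T. norm (p - xbar - t) \<le> \<eta> * norm (p - xbar)"
      using T1[OF \<eta>] unfolding eventually_nhds_metric by blast
    obtain d2 where "d2 > 0" and d2: "\<And>t. norm t < d2 \<Longrightarrow> t \<in> T \<Longrightarrow> \<exists>q\<in>M. norm (q - xbar - t) \<le> \<eta> * norm t"
      using T2[OF \<eta>] unfolding eventually_nhds_metric by (auto simp: dist_norm)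
    \<comment> \<open>The half accounts for \<open>p\<close>, which may be twice as far from
      \<open>xbar\<close> as \<open>y\<close>.\<close>
    have "\<forall>\<^sub>F y in nhds xbar. dist y xbar < min (d1 / 2) d2"
      unfolding eventually_nhds_metric using \<open>d1 > 0\<close> \<open>d2 > 0\<close> by (intro exI[of _ "min (d1 / 2) d2"]) auto
    with C2_manifold_closest_point_exists[OF assms]
    show "\<forall>\<^sub>F y in nhds xbar. norm (y - closest_point M y - N (y - xbar)) \<le> e0 * norm (y - xbar)"
    proof eventually_elim
      case (elim y)
      define r where "r = norm (y - xbar)"
      define p where "p = closest_point M y"
      have "p \<in> M" and pmin: "\<And>q. q \<in> M \<Longrightarrow> norm (y - p) \<le> norm (y - q)"
        using elim(1) by (auto simp: p_def dist_norm)
      have r0: "r \<ge> 0" by (simp add: r_def)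
      have "norm (p - xbar) \<le> norm (y - p) + norm (y - xbar)"
        using norm_triangle_ineq[of "p - y" "y - xbar"] by (simp add: norm_minus_commute)
      then have p2: "norm (p - xbar) \<le> 2 * r" using pmin[OF \<open>xbar \<in> M\<close>] by (simp add: r_def)
      then have "dist p xbar < d1" using elim(2) by (simp add: dist_norm r_def)
      then obtain t where t: "t \<in> T" "norm (p - xbar - t) \<le> \<eta> * norm (p - xbar)" using d1 \<open>p \<in> M\<close> by blast
      define n s where "n = N (y - xbar)" and "s = y - xbar - n"
      have "s \<in> T" using N(1) by (simp add: s_def n_def)
      have sr: "norm s \<le> r" using tle by (simp add: s_def n_def r_def)
      have nr: "norm n \<le> r" using lip[of "y - xbar" 0] N0 by (simp add: n_def r_def)
      obtain q where q: "q \<in> M" "norm (q - xbar - s) \<le> \<eta> * norm s"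
        using d2[OF _ \<open>s \<in> T\<close>] sr elim(2) by (auto simp: r_def dist_norm)
      define E where "E = p - xbar - t"
      have E: "norm E \<le> 2 * \<eta> * r"
      proof -
        have "norm E \<le> \<eta> * (2 * r)" using t(2) p2 \<eta> unfolding E_def by (meson mult_left_mono less_imp_le order_trans)
        then show ?thesis by simp
      qed
      have "norm (y - q) \<le> norm n + norm (q - xbar - s)"
      proof -
        have "y - q = n - (q - xbar - s)" by (simp add: s_def)
        then show ?thesis by (metis norm_triangle_ineq4)
      qed
      also have "\<dots> \<le> norm n + \<eta> * r" using q(2) mult_left_mono[OF sr, of \<eta>] \<eta> by linarith
      finally have up: "norm (y - p) \<le> norm n + \<eta> * r" using pmin[OF q(1)] by linarith
      have yp: "y - p = (s - t) + n - E" by (simp add: s_def E_def)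
      have "norm ((s - t) + n) \<le> norm (y - p) + norm E"
        unfolding yp by (metis diff_add_cancel norm_triangle_ineq)
      then have "norm ((s - t) + n) \<le> norm n + 3 * \<eta> * r" using up E by (simp add: algebra_simps)
      then have "(norm ((s - t) + n))\<^sup>2 \<le> (norm n + 3 * \<eta> * r)\<^sup>2" by (intro power_mono) auto
      moreover have "(norm ((s - t) + n))\<^sup>2 = (norm (s - t))\<^sup>2 + (norm n)\<^sup>2"
        using pyth N(2) subspace_diff[OF T \<open>s \<in> T\<close> t(1)] n_def by blast
      ultimately have "(norm (s - t))\<^sup>2 \<le> 6 * \<eta> * (r * norm n) + 9 * \<eta> * (\<eta> * r\<^sup>2)"
        by (simp add: power2_sum power_mult_distrib power2_eq_square algebra_simps)
      also have "\<dots> \<le> 6 * \<eta> * r\<^sup>2 + 9 * \<eta> * r\<^sup>2"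
      proof (intro add_mono mult_left_mono)
        show "r * norm n \<le> r\<^sup>2" using nr r0 by (simp add: power2_eq_square mult_left_mono)
        have "\<eta> \<le> 1" using power_le_one[of e 2] e by (simp add: \<eta>_def)
        then show "\<eta> * r\<^sup>2 \<le> r\<^sup>2" using mult_right_mono[of \<eta> 1 "r\<^sup>2"] by simp
      qed (use \<eta> in auto)
      also have "\<dots> \<le> (e / 2 * r)\<^sup>2"
        using mult_nonneg_nonneg[of "e\<^sup>2" "r\<^sup>2"] by (simp add: \<eta>_def power_mult_distrib power_divide)
      finally have "norm (s - t) \<le> e / 2 * r"
        by (rule power2_le_imp_le) (use e r0 in simp)
      moreover have "norm E \<le> e / 2 * r"
      proof -
        have "e * e \<le> e * 1" using e by (intro mult_left_mono) auto
        then have "2 * \<eta> \<le> e / 2" using e unfolding \<eta>_def power2_eq_square by linarith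
        then show ?thesis using E mult_right_mono[OF _ r0] by (meson order_trans)
      qed
      moreover have "y - p - n = (s - t) - E" by (simp add: yp)
      ultimately have "norm (y - p - n) \<le> e * r" using norm_triangle_ineq4[of "s - t" E] by simp
      also have "\<dots> \<le> e0 * r" using e r0 by (intro mult_right_mono)
      finally show ?case by (simp add: p_def n_def r_def)
    qed
  qed
qed

lemma has_derivative_right_quotient:
  fixes F :: "'a::real_normed_vector \<Rightarrow> 'b::real_normed_vector"
  assumes "(F has_derivative D) (at x)"
  shows "((\<lambda>t. (F (x + t *\<^sub>R u) - F x) /\<^sub>R t) \<longlongrightarrow> D u) (at_right 0)"
proof (rule tendstoI)
  fix e :: real assume "e > 0"
  define e' where "e' = e / (norm u + 1)"
  have u1: "norm u + 1 > 0" by (simp add: add_nonneg_pos)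
  have e': "e' > 0" using \<open>e > 0\<close> u1 by (simp add: e'_def)
  have "((\<lambda>t. x + t *\<^sub>R u) \<longlongrightarrow> x + 0 *\<^sub>R u) (at_right 0)" by (intro tendsto_intros tendsto_ident_at)
  then have "filterlim (\<lambda>t. x + t *\<^sub>R u) (nhds x) (at_right 0)" by simp
  from eventually_compose_filterlim[OF has_derivative_eventually_norm_le[OF assms e'] this]
  have "\<forall>\<^sub>F t in at_right 0. norm (F (x + t *\<^sub>R u) - F x - D (x + t *\<^sub>R u - x)) \<le> e' * norm (x + t *\<^sub>R u - x)" .
  moreover have "\<forall>\<^sub>F t in at_right 0. (0::real) < t" by (simp add: eventually_at_right_less)
  ultimately show "\<forall>\<^sub>F t in at_right 0. dist ((F (x + t *\<^sub>R u) - F x) /\<^sub>R t) (D u) < e"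
  proof eventually_elim
    case (elim t)
    have "D (t *\<^sub>R u) = t *\<^sub>R D u" using has_derivative_linear[OF assms] by (simp add: linear_scale)
    then have "(F (x + t *\<^sub>R u) - F x) /\<^sub>R t - D u = (F (x + t *\<^sub>R u) - F x - D (x + t *\<^sub>R u - x)) /\<^sub>R t"
      using elim(2) by (simp add: scaleR_diff_right)
    then have "dist ((F (x + t *\<^sub>R u) - F x) /\<^sub>R t) (D u) = norm (F (x + t *\<^sub>R u) - F x - D (x + t *\<^sub>R u - x)) / t"
      using elim(2) by (simp add: dist_norm divide_inverse mult.commute)
    also have "\<dots> \<le> e' * norm (x + t *\<^sub>R u - x) / t" using elim by (intro divide_right_mono) simp_all
    also have "\<dots> = e' * norm u" using elim(2) by simp
    also have "\<dots> < e' * (norm u + 1)" using e' by simp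
    also have "\<dots> = e" using u1 by (simp add: e'_def)
    finally show ?case .
  qed
qed

text \<open>In the chart, growth of \<open>f\<close> becomes growth of \<open>h\<close> on the flat
  space \<open>S\<close>, and the radial derivative of \<open>h\<close> at \<open>z\<close> is at
  least of order \<open>(norm (z - w))\<^sup>2\<close>. Pairing a subgradient with the corresponding
  tangent vector, of length of order \<open>norm (z - w)\<close>, leaves a linear lower bound on its
  norm.\<close>

lemma subgradient_norm_ge_on_manifold:
  fixes f :: "'a::euclidean_space \<Rightarrow> real"
  assumes f: "locally_lipschitz f" and man: "C2_manifold_around M xbar"
    and reg: "\<And>x. x \<in> M \<Longrightarrow> subdifferentially_regular f x" and C2r: "C2_restriction M f"
    and "\<delta> > 0" and growth: "\<forall>\<^sub>F x in nhds xbar. \<delta> / 2 * (norm (x - xbar))\<^sup>2 \<le> f x - f xbar"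
  obtains \<beta> where "\<beta> > 0"
    "\<forall>\<^sub>F p in nhds xbar. p \<in> M \<longrightarrow> (\<forall>v\<in>clarke_subdifferential f p. \<beta> * norm (p - xbar) \<le> norm v)"
proof -
  obtain U V S :: "'a set" and \<phi> \<psi> :: "'a \<Rightarrow> 'a" and \<phi>' \<psi>' :: "'a \<Rightarrow> 'a \<Rightarrow>\<^sub>L 'a"
    and \<psi>'' :: "'a \<Rightarrow> 'a \<Rightarrow> 'a \<Rightarrow>\<^sub>L 'a"
    where U: "open U" "xbar \<in> U" and V: "open V" and hom: "homeomorphism U V \<phi> \<psi>"
    and S: "subspace S" and M: "\<phi> ` (M \<inter> U) = S \<inter> V" and "xbar \<in> M"
    and \<phi>': "\<And>x. x \<in> U \<Longrightarrow> (\<phi> has_derivative \<phi>' x) (at x)"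
    and \<psi>': "\<And>z. z \<in> V \<Longrightarrow> (\<psi> has_derivative \<psi>' z) (at z)"
    and \<psi>'': "\<And>z. z \<in> V \<Longrightarrow> (\<psi>' has_derivative \<psi>'' z) (at z)"
    by (rule C2_manifold_chart[OF man]) (rule that)
  obtain W and g :: "'a \<Rightarrow> real" where W: "open W" "xbar \<in> W" and "C2_on W g" and fg: "\<And>z. z \<in> M \<inter> W \<Longrightarrow> f z = g z"
    using C2r \<open>xbar \<in> M\<close> unfolding C2_restriction_def by metis
  obtain g' :: "'a \<Rightarrow> 'a \<Rightarrow>\<^sub>L real" and g'' :: "'a \<Rightarrow> 'a \<Rightarrow>\<^sub>L ('a \<Rightarrow>\<^sub>L real)"
    where g': "\<forall>x\<in>W. (g has_derivative g' x) (at x)" and g'': "\<forall>x\<in>W. (g' has_derivative g'' x) (at x)"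
    using \<open>C2_on W g\<close>[unfolded C2_on_def] by (elim exE conjE) (rule that)
  have \<phi>\<psi>: "\<phi> (\<psi> z) = z" "\<psi> z \<in> U" if "z \<in> V" for z using hom that by (auto simp: homeomorphism_def)
  have \<psi>\<phi>: "\<psi> (\<phi> p) = p" "\<phi> p \<in> V" if "p \<in> U" for p using hom that by (auto simp: homeomorphism_def)
  have inM: "\<psi> z \<in> M" if z: "z \<in> S" "z \<in> V" for z
  proof -
    have "z \<in> \<phi> ` (M \<inter> U)" using M z by simp
    then obtain q where "q \<in> M \<inter> U" "\<phi> q = z" by blast
    then show ?thesis using \<psi>\<phi> by auto
  qed
  define w where "w = \<phi> xbar"
  have w: "w \<in> S" "w \<in> V" using M U \<open>xbar \<in> M\<close> by (auto simp: w_def)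
  have \<psi>w: "\<psi> w = xbar" using \<psi>\<phi> U by (simp add: w_def)
  define V' where "V' = V \<inter> \<psi> -` W"
  have V': "open V'" "w \<in> V'"
    using continuous_open_preimage[of V \<psi> W] hom V W w \<psi>w by (auto simp: V'_def homeomorphism_def)
  define h where "h z = g (\<psi> z)" for z
  define h' where "h' z = g' (\<psi> z) o\<^sub>L \<psi>' z" for z
  \<comment> \<open>The smooth \<open>g\<close> agrees with \<open>f\<close> on \<open>M\<close>
    only, so all comparisons between \<open>f\<close> and \<open>h\<close> must stay within
    \<open>S\<close>.\<close>
  have fh: "f (\<psi> z) = h z" if "z \<in> S" "z \<in> V'" for z
    using fg[of "\<psi> z"] inM that by (simp add: h_def V'_def)
  have hd: "(h has_derivative h' z) (at z)" if "z \<in> V'" for z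
  proof -
    have "((\<lambda>z. g (\<psi> z)) has_derivative (\<lambda>d. g' (\<psi> z) (\<psi>' z d))) (at z)"
      by (rule has_derivative_compose[OF \<psi>']) (use that g' in \<open>auto simp: V'_def\<close>)
    then show ?thesis unfolding h_def[abs_def] h'_def
      by (rule has_derivative_eq_rhs) auto
  qed
  have "((\<lambda>z. g' (\<psi> z)) has_derivative (\<lambda>d. g'' (\<psi> w) (\<psi>' w d))) (at w)"
    by (rule has_derivative_compose[OF \<psi>'[OF w(2)]]) (use g'' W \<psi>w in auto)
  from bounded_bilinear.FDERIV[OF bounded_bilinear_blinfun_compose this \<psi>''[OF w(2)]]
  obtain H where h'': "(h' has_derivative H) (at w)" unfolding h'_def[abs_def] by blast
  have lim\<phi>: "filterlim \<phi> (nhds w) (nhds xbar)"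
    using has_derivative_continuous[OF \<phi>'[OF U(2)]] unfolding w_def
    by (simp add: isCont_def tendsto_at_iff_tendsto_nhds)
  have "filterlim \<psi> (nhds (\<psi> w)) (nhds w)"
    using has_derivative_continuous[OF \<psi>'[OF w(2)]]
    by (simp add: isCont_def tendsto_at_iff_tendsto_nhds)
  then have lim\<psi>: "filterlim \<psi> (nhds xbar) (nhds w)" by (simp only: \<psi>w)
  obtain C where "C > 0" and C: "\<forall>\<^sub>F p in nhds xbar. norm (\<phi> p - \<phi> xbar) \<le> C * norm (p - xbar)"
    using has_derivative_eventually_lipschitz[OF \<phi>'[OF U(2)]] by blast
  \<comment> \<open>Growth is given in terms of \<open>norm (\<psi> z - xbar)\<close>, and
    \<open>norm (z - w)\<close> is at most \<open>C\<close> times that.\<close>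
  define c where "c = \<delta> / 2 / C\<^sup>2"
  have "c > 0" using \<open>\<delta> > 0\<close> \<open>C > 0\<close> by (simp add: c_def)
  have "\<forall>\<^sub>F z in nhds w. z - w \<in> S \<longrightarrow> c * (norm (z - w))\<^sup>2 \<le> h z - h w"
    using eventually_compose_filterlim[OF growth lim\<psi>] eventually_compose_filterlim[OF C lim\<psi>]
      eventually_nhds_in_open[OF V']
  proof eventually_elim
    case (elim z)
    show ?case
    proof
      assume "z - w \<in> S"
      then have "z \<in> S" using subspace_add[OF S _ w(1)] by fastforce
      have "norm (z - w) \<le> C * norm (\<psi> z - xbar)" using elim(2,3) \<phi>\<psi>(1) by (simp add: w_def V'_def)
      then have "(norm (z - w))\<^sup>2 \<le> (C * norm (\<psi> z - xbar))\<^sup>2" by (intro power_mono) auto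
      then have "c * (norm (z - w))\<^sup>2 \<le> c * (C * norm (\<psi> z - xbar))\<^sup>2"
        using \<open>c > 0\<close> by (intro mult_left_mono) auto
      also have "\<dots> = \<delta> / 2 * (norm (\<psi> z - xbar))\<^sup>2" using \<open>C > 0\<close> by (simp add: c_def power_mult_distrib)
      also have "\<dots> \<le> f (\<psi> z) - f (\<psi> w)" using elim(1) \<psi>w by simp
      also have "\<dots> = h z - h w" using fh \<open>z \<in> S\<close> elim(3) w V' by simp
      finally show "c * (norm (z - w))\<^sup>2 \<le> h z - h w" .
    qed
  qed
  from radial_derivative_ge[OF V' hd h'' S \<open>c > 0\<close> this]
  have radial: "\<forall>\<^sub>F z in nhds w. z - w \<in> S \<longrightarrow> c / 2 * (norm (z - w))\<^sup>2 \<le> h' z (z - w)" .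
  define B where "B = norm (\<psi>' w) + 1"
  have "B > 0" by (simp add: B_def add_nonneg_pos)
  have "((\<lambda>z. norm (\<psi>' z)) \<longlongrightarrow> norm (\<psi>' w)) (nhds w)"
    using has_derivative_continuous[OF \<psi>''[OF w(2)]]
    by (intro tendsto_norm) (simp add: isCont_def tendsto_at_iff_tendsto_nhds)
  then have B: "\<forall>\<^sub>F z in nhds w. norm (\<psi>' z) < B" by (rule order_tendstoD) (simp add: B_def)
  obtain C3 where "C3 > 0" and C3: "\<forall>\<^sub>F z in nhds w. norm (\<psi> z - \<psi> w) \<le> C3 * norm (z - w)"
    using has_derivative_eventually_lipschitz[OF \<psi>'[OF w(2)]] by blast
  define \<beta> where "\<beta> = c / 2 / (B * C3)"
  have "\<beta> > 0" using \<open>c > 0\<close> \<open>B > 0\<close> \<open>C3 > 0\<close> by (simp add: \<beta>_def)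
  moreover have "\<forall>\<^sub>F p in nhds xbar. p \<in> M \<longrightarrow> (\<forall>v\<in>clarke_subdifferential f p. \<beta> * norm (p - xbar) \<le> norm v)"
    using eventually_compose_filterlim[OF radial lim\<phi>] eventually_compose_filterlim[OF B lim\<phi>]
      eventually_compose_filterlim[OF C3 lim\<phi>] eventually_compose_filterlim[OF eventually_nhds_in_open[OF V'] lim\<phi>]
      eventually_nhds_in_open[OF U]
  proof eventually_elim
    case (elim p)
    show ?case
    proof (intro impI ballI)
      fix v assume "p \<in> M" and v: "v \<in> clarke_subdifferential f p"
      define z d where "z = \<phi> p" and "d = z - w"
      have z: "z \<in> S" "z \<in> V'" "z \<in> V" and pz: "p = \<psi> z"
        using M \<open>p \<in> M\<close> elim(4,5) \<psi>\<phi> by (auto simp: z_def)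
      have "d \<in> S" using subspace_diff[OF S z(1) w(1)] by (simp add: d_def)
      \<comment> \<open>The curve runs from \<open>p\<close> towards \<open>xbar\<close>: negating
        the upper bound in direction \<open>- d\<close> gives a lower bound on
        \<open>v \<bullet> \<psi>' z d\<close>.\<close>
      have "v \<bullet> (\<psi>' z (- d)) \<le> h' z (- d)"
      proof (rule regular_subgradient_le_curve_derivative[OF f reg[OF \<open>p \<in> M\<close>] _ _ v])
        show "((\<lambda>t. (\<psi> (z + t *\<^sub>R (- d)) - p) /\<^sub>R t) \<longlongrightarrow> \<psi>' z (- d)) (at_right 0)"
          unfolding pz by (rule has_derivative_right_quotient[OF \<psi>'[OF z(3)]])
        have "((\<lambda>t. z + t *\<^sub>R (- d)) \<longlongrightarrow> z + 0 *\<^sub>R (- d)) (at_right 0)"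
          by (intro tendsto_intros tendsto_ident_at)
        from topological_tendstoD[OF this V'(1)]
        have ev: "\<forall>\<^sub>F t in at_right 0. z + t *\<^sub>R (- d) \<in> V'" using z(2) by simp
        have inS: "z + t *\<^sub>R (- d) \<in> S" for t
          using S z(1) \<open>d \<in> S\<close> by (intro subspace_add subspace_scale subspace_neg)
        show "((\<lambda>t. (f (\<psi> (z + t *\<^sub>R (- d))) - f p) / t) \<longlongrightarrow> h' z (- d)) (at_right 0)"
        proof (rule Lim_transform_eventually[OF has_derivative_right_quotient[OF hd[OF z(2)]]])
          show "\<forall>\<^sub>F t in at_right 0. (h (z + t *\<^sub>R (- d)) - h z) /\<^sub>R t = (f (\<psi> (z + t *\<^sub>R (- d))) - f p) / t"
            using ev
          proof eventually_elim
            case (elim t)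
            then show ?case using fh[OF inS elim] fh[OF z(1,2)] pz by (simp add: divide_inverse mult.commute)
          qed
        qed
      qed
      then have "h' z d \<le> v \<bullet> (\<psi>' z d)" by (simp add: blinfun.minus_right)
      also have "\<dots> \<le> norm v * norm (\<psi>' z d)" by (rule norm_cauchy_schwarz)
      also have "\<dots> \<le> norm v * (B * norm d)"
      proof (rule mult_left_mono)
        have "norm (\<psi>' z d) \<le> norm (\<psi>' z) * norm d" by (rule norm_blinfun)
        also have "\<dots> \<le> B * norm d" using elim(2) by (intro mult_right_mono) (auto simp: z_def)
        finally show "norm (\<psi>' z d) \<le> B * norm d" .
      qed simp
      finally have "c / 2 * (norm d)\<^sup>2 \<le> norm v * (B * norm d)"
        using elim(1) \<open>d \<in> S\<close> by (simp add: z_def[symmetric] d_def[symmetric])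
      then have le: "c / 2 * norm d \<le> norm v * B"
        by (cases "d = 0") (use \<open>B > 0\<close> in \<open>auto simp: power2_eq_square\<close>)
      have "norm (p - xbar) \<le> C3 * norm d" using elim(3) unfolding z_def[symmetric] d_def[symmetric] pz[symmetric] \<psi>w .
      then have "\<beta> * norm (p - xbar) \<le> \<beta> * (C3 * norm d)" using \<open>\<beta> > 0\<close> by simp
      also have "\<dots> = (c / 2 * norm d) / B" using \<open>C3 > 0\<close> by (simp add: \<beta>_def)
      also have "\<dots> \<le> norm v" using le \<open>B > 0\<close> by (simp add: pos_divide_le_eq)
      finally show "\<beta> * norm (p - xbar) \<le> norm v" .
    qed
  qed
  ultimately show ?thesis by (rule that)
qed

section \<open>Linear growth of the Goldstein modulus\<close>

theorem theorem5p11: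
  fixes f :: "'a::euclidean_space \<Rightarrow> real" and xbar :: 'a
  assumes "locally_lipschitz f"
    and "grows_robustly_at f xbar"
  shows "\<exists>\<alpha>>0. \<forall>\<^sub>F x in nhds xbar. goldstein_modulus f x \<ge> \<alpha> * norm (x - xbar)"
proof -
  note f = assms(1)
  obtain M where "xbar \<in> M" and man: "C2_manifold_around M xbar" and rob: "grows_robustly_relative f M xbar"
    using assms(2) unfolding grows_robustly_at_def by blast
  obtain \<delta> where \<delta>: "\<delta> > 0" "\<forall>\<^sub>F x in nhds xbar. \<delta> / 2 * (norm (x - xbar))\<^sup>2 \<le> f x - f xbar"
    using rob unfolding grows_robustly_relative_def by blast
  have reg: "\<And>x. x \<in> M \<Longrightarrow> subdifferentially_regular f x" and C2r: "C2_restriction M f"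
    using rob unfolding grows_robustly_relative_def by blast+
  obtain \<beta> where "\<beta> > 0" and
    \<beta>: "\<forall>\<^sub>F p in nhds xbar. p \<in> M \<longrightarrow> (\<forall>v\<in>clarke_subdifferential f p. \<beta> * norm (p - xbar) \<le> norm v)"
    using subgradient_norm_ge_on_manifold[OF f man reg C2r \<delta>] by blast
  obtain K where "K > 0" and "\<forall>\<^sub>F (x, y) in nhds xbar \<times>\<^sub>F nhds xbar. x \<in> M \<longrightarrow>
      clarke_subdifferential f y \<subseteq>
        {u + w | u w. u \<in> clarke_subdifferential f x \<and> w \<in> cball 0 (K * norm (x - y))}"
    using rob unfolding grows_robustly_relative_def by blast
  then obtain P Q where PQ: "eventually P (nhds xbar)" "eventually Q (nhds xbar)"
    and K: "\<And>x y. P x \<Longrightarrow> Q y \<Longrightarrow> x \<in> M \<Longrightarrow> clarke_subdifferential f y \<subseteq>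
        {u + w | u w. u \<in> clarke_subdifferential f x \<and> w \<in> cball 0 (K * norm (x - y))}"
    unfolding eventually_prod_filter by auto
  obtain \<mu> where "\<mu> > 0" and aim: "\<forall>\<^sub>F x in nhds xbar. \<forall>v\<in>clarke_subdifferential f x.
      \<mu> * infdist x M \<le> v \<bullet> (x - closest_point M x)"
    using rob unfolding grows_robustly_relative_def by blast
  obtain r0 L0 where "r0 > 0" and lip: "L0-lipschitz_on (ball xbar r0) f"
    using locally_lipschitz_obtain[OF f] by blast
  define L where "L = L0 + 1"
  have "L > 0" using lipschitz_on_nonneg[OF lip] by (simp add: L_def)
  obtain N :: "'a \<Rightarrow> 'a" where N1: "\<And>a. norm (N a) \<le> norm a" and N2: "\<And>a b. norm (N a - N b) \<le> norm (a - b)"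
    and N3: "\<And>e. e > 0 \<Longrightarrow> \<forall>\<^sub>F y in nhds xbar. norm (y - closest_point M y - N (y - xbar)) \<le> e * norm (y - xbar)"
    using closest_point_normal_approx[OF man] by blast
  \<comment> \<open>With \<open>c \<le> 1 / 2\<close> the projection of a near point keeps distance
    at least \<open>r / 2\<close> from \<open>xbar\<close>; the other bound limits the drift
    \<open>K * c\<close> of subgradients.\<close>
  define c where "c = min (1 / 2) (\<beta> / (8 * K))"
  have c: "c > 0" "c \<le> 1 / 2" "K * c \<le> \<beta> / 8"
  proof -
    show "c > 0" "c \<le> 1 / 2" using \<open>\<beta> > 0\<close> \<open>K > 0\<close> by (auto simp: c_def)
    have "K * c \<le> K * (\<beta> / (8 * K))" using \<open>K > 0\<close> by (intro mult_left_mono) (auto simp: c_def)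
    then show "K * c \<le> \<beta> / 8" using \<open>K > 0\<close> by simp
  qed
  define \<eta> where "\<eta> = \<mu> * c / (16 * L)"
  have "\<eta> > 0" using \<open>\<mu> > 0\<close> \<open>c > 0\<close> \<open>L > 0\<close> by (simp add: \<eta>_def)
  have L\<eta>: "L * \<eta> = \<mu> * c / 16" using \<open>L > 0\<close> by (simp add: \<eta>_def)
  \<comment> \<open>The first two entries serve the near case. The next three serve the far case:
    loss of distance to \<open>M\<close>, variation of \<open>N\<close>, and the final bound. The
    entry 1 keeps the ball around \<open>x\<close> within distance \<open>2 * r\<close> of
    \<open>xbar\<close>.\<close>
  define A where "A = {\<beta> / 8, \<beta> / (8 * K), c / 4, \<mu> * c / (8 * L), \<mu> * c / 2, 1}"
  define \<alpha> where "\<alpha> = Min A"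
  have "\<alpha> \<in> A" unfolding \<alpha>_def by (rule Min_in) (auto simp: A_def)
  moreover have "\<forall>a\<in>A. 0 < a"
    using \<open>\<beta> > 0\<close> \<open>K > 0\<close> \<open>c > 0\<close> \<open>\<mu> > 0\<close> \<open>L > 0\<close> by (simp add: A_def)
  ultimately have "\<alpha> > 0" by blast
  have \<alpha>A: "\<alpha> \<le> a" if "a \<in> A" for a unfolding \<alpha>_def by (rule Min_le) (use that in \<open>auto simp: A_def\<close>)
  have \<alpha>: "\<alpha> \<le> \<beta> / 8" "\<alpha> \<le> c / 4" "\<alpha> \<le> \<mu> * c / 2" "\<alpha> \<le> 1"
    using \<alpha>A[of "\<beta> / 8"] \<alpha>A[of "c / 4"] \<alpha>A[of "\<mu> * c / 2"] \<alpha>A[of 1] by (simp_all add: A_def)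
  have K\<alpha>: "K * \<alpha> \<le> \<beta> / 8" using mult_left_mono[OF \<alpha>A[of "\<beta> / (8 * K)"], of K] \<open>K > 0\<close> by (simp add: A_def)
  have L\<alpha>: "L * \<alpha> \<le> \<mu> * c / 8" using mult_left_mono[OF \<alpha>A[of "\<mu> * c / (8 * L)"], of L] \<open>L > 0\<close> by (simp add: A_def)
  have \<mu>\<alpha>: "\<mu> * \<alpha> \<le> \<mu> * c / 4" using mult_left_mono[OF \<alpha>(2), of \<mu>] \<open>\<mu> > 0\<close> by simp
  have "\<forall>\<^sub>F y in nhds xbar.
      (closest_point M y \<in> M \<and> (\<forall>q\<in>M. dist y (closest_point M y) \<le> dist y q)) \<and>
      (y \<in> M \<longrightarrow> (\<forall>v\<in>clarke_subdifferential f y. \<beta> * norm (y - xbar) \<le> norm v)) \<and> P y \<and> Q y \<and>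
      (\<forall>v\<in>clarke_subdifferential f y. \<mu> * infdist y M \<le> v \<bullet> (y - closest_point M y)) \<and>
      norm (y - closest_point M y - N (y - xbar)) \<le> \<eta> * norm (y - xbar) \<and> y \<in> ball xbar r0 \<and> y \<in> ball xbar 1"
    by (intro eventually_conj C2_manifold_closest_point_exists[OF man] \<beta> PQ aim N3[OF \<open>\<eta> > 0\<close>]
        eventually_nhds_in_open open_ball) (use \<open>r0 > 0\<close> in auto)
  then obtain \<rho> where "\<rho> > 0" and near: "\<And>y. dist y xbar < \<rho> \<Longrightarrow>
      (closest_point M y \<in> M \<and> (\<forall>q\<in>M. dist y (closest_point M y) \<le> dist y q)) \<and>
      (y \<in> M \<longrightarrow> (\<forall>v\<in>clarke_subdifferential f y. \<beta> * norm (y - xbar) \<le> norm v)) \<and> P y \<and> Q y \<and>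
      (\<forall>v\<in>clarke_subdifferential f y. \<mu> * infdist y M \<le> v \<bullet> (y - closest_point M y)) \<and>
      norm (y - closest_point M y - N (y - xbar)) \<le> \<eta> * norm (y - xbar) \<and> y \<in> ball xbar r0 \<and> y \<in> ball xbar 1"
    unfolding eventually_nhds_metric by blast
  have "\<alpha> * norm (x - xbar) \<le> goldstein_modulus f x" if x: "dist x xbar < \<rho> / 2" for x
  proof (rule goldstein_modulus_ge[OF f])
    fix \<epsilon> g assume "0 \<le> \<epsilon>" and \<epsilon>: "\<epsilon> < \<alpha> * norm (x - xbar)" and g: "g \<in> goldstein_subdifferential \<epsilon> f x"
    define r where "r = norm (x - xbar)"
    have "r \<noteq> 0" using \<open>0 \<le> \<epsilon>\<close> \<epsilon> by (auto simp: r_def)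
    then have r: "r > 0" "2 * r < \<rho>" using x by (auto simp: r_def dist_norm)
    have \<alpha>r: "\<alpha> * r \<le> 1 * r" using \<alpha>(4) r(1) by (intro mult_right_mono) auto
    have y: "dist y x \<le> \<alpha> * r" "norm (y - xbar) \<le> 2 * r" if "y \<in> cball x \<epsilon>" for y
    proof -
      show "dist y x \<le> \<alpha> * r" using that \<epsilon> by (simp add: r_def dist_commute)
      then have "dist y xbar \<le> \<alpha> * r + r"
        using dist_triangle[of y xbar x] by (simp add: r_def dist_norm)
      then show "norm (y - xbar) \<le> 2 * r" using \<alpha>r by (simp add: dist_norm)
    qed
    define p where "p = closest_point M x"
    have nx: "dist x xbar < \<rho>" using x \<open>\<rho> > 0\<close> by simp
    have "p \<in> M" and pmin: "\<And>q. q \<in> M \<Longrightarrow> dist x p \<le> dist x q" using near[OF nx] by (auto simp: p_def)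
    have inf: "infdist x M = dist x p"
    proof (rule antisym)
      show "infdist x M \<le> dist x p" using \<open>p \<in> M\<close> by (rule infdist_le)
      show "dist x p \<le> infdist x M"
        unfolding infdist_def using \<open>p \<in> M\<close> pmin by (auto intro: cINF_greatest)
    qed
    show "\<alpha> * norm (x - xbar) \<le> norm g"
    proof (cases "dist x p < c * r")
      case True
      define R where "R = (c + \<alpha>) * r"
      have px: "dist p xbar \<le> 2 * r"
        using dist_triangle[of p xbar x] pmin[OF \<open>xbar \<in> M\<close>] by (simp add: r_def dist_norm norm_minus_commute)
      then have np: "dist p xbar < \<rho>" using r by simp
      let ?Q = "{u + w | u w. u \<in> clarke_subdifferential f p \<and> w \<in> cball 0 (K * R)}"
      have "clarke_subdifferential f y \<subseteq> ?Q" if "y \<in> cball x \<epsilon>" for y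
      proof -
        have "dist y xbar < \<rho>" using y(2)[OF that] r by (simp add: dist_norm)
        then have "clarke_subdifferential f y \<subseteq>
            {u + w | u w. u \<in> clarke_subdifferential f p \<and> w \<in> cball 0 (K * norm (p - y))}"
          using K near np \<open>p \<in> M\<close> by blast
        moreover have "norm (p - y) \<le> R"
        proof -
          have "norm (p - y) \<le> dist x p + dist y x"
            using dist_triangle[of p y x] by (simp add: dist_norm norm_minus_commute)
          then show ?thesis using True y(1)[OF that] by (simp add: R_def algebra_simps)
        qed
        then have "K * norm (p - y) \<le> K * R" using \<open>K > 0\<close> by simp
        then have "cball 0 (K * norm (p - y)) \<subseteq> cball (0::'a) (K * R)" by (rule subset_cball)
        ultimately show ?thesis by blast
      qed
      \<comment> \<open>Convexity of the enlarged subdifferential at \<open>p\<close> is what lets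
        it absorb the hull. Its elements have norm at least
        \<open>\<beta> / 2 * r - \<beta> / 4 * r\<close>.\<close>
      moreover have "convex ?Q"
        using convex_sums[OF convex_clarke[OF f, of p] convex_cball[of 0 "K * R"]]
        by (rule back_subst[of convex]) blast
      ultimately have "goldstein_subdifferential \<epsilon> f x \<subseteq> ?Q"
        unfolding goldstein_subdifferential_def by (intro hull_minimal UN_least)
      then obtain u w where uw: "g = u + w" "u \<in> clarke_subdifferential f p" "norm w \<le> K * R"
        using g by auto
      have "\<beta> * norm (p - xbar) \<le> norm u" using near[OF np] \<open>p \<in> M\<close> uw(2) by blast
      moreover have "r / 2 \<le> norm (p - xbar)"
      proof -
        have "r \<le> dist x p + norm (p - xbar)"
          using dist_triangle[of x xbar p] by (simp add: r_def dist_norm)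
        moreover have "c * r \<le> 1 / 2 * r" using c(2) r(1) by (intro mult_right_mono) auto
        ultimately show ?thesis using True by simp
      qed
      then have "\<beta> * (r / 2) \<le> \<beta> * norm (p - xbar)" using \<open>\<beta> > 0\<close> by (intro mult_left_mono) auto
      moreover have "K * R \<le> \<beta> / 4 * r"
      proof -
        have "K * R = (K * c + K * \<alpha>) * r" by (simp add: R_def algebra_simps)
        also have "\<dots> \<le> \<beta> / 4 * r" using c(3) K\<alpha> r(1) by (intro mult_right_mono) auto
        finally show ?thesis .
      qed
      moreover have "norm u - norm w \<le> norm g" using norm_diff_ineq[of u w] uw(1) by simp
      moreover have "\<alpha> * r \<le> \<beta> / 8 * r" using \<alpha>(1) r(1) by (intro mult_right_mono) auto
      moreover have "0 < \<beta> * r" using \<open>\<beta> > 0\<close> r(1) by simp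
      ultimately show ?thesis using uw(3) by (simp add: r_def[symmetric])
    next
      case False
      define w where "w = N (x - xbar)"
      \<comment> \<open>The half-space does not depend on \<open>y\<close>. Aiming gives
        \<open>\<mu> * c * r\<close> less a quarter for the distance from \<open>y\<close> to
        \<open>x\<close>; replacing \<open>n\<close> by \<open>w\<close> costs another quarter, so
        one half remains.\<close>
      have "clarke_subdifferential f y \<subseteq> {v. \<mu> * c / 2 * r \<le> w \<bullet> v}" if yx: "y \<in> cball x \<epsilon>" for y
      proof
        fix v assume v: "v \<in> clarke_subdifferential f y"
        have ny: "dist y xbar < \<rho>" using y(2)[OF yx] r by (simp add: dist_norm)
        define n e where "n = y - closest_point M y" and "e = n - N (y - xbar)"
        have "norm v \<le> L" using clarke_norm_le[OF f lip _ v] near[OF ny] by (auto simp: L_def)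
        have "norm e \<le> \<eta> * (2 * r)"
        proof -
          have "norm e \<le> \<eta> * norm (y - xbar)" using near[OF ny] by (simp add: e_def n_def)
          also have "\<dots> \<le> \<eta> * (2 * r)" using y(2)[OF yx] \<open>\<eta> > 0\<close> by (intro mult_left_mono) auto
          finally show ?thesis .
        qed
        moreover have "norm (N (y - xbar) - w) \<le> \<alpha> * r"
          using N2[of "y - xbar" "x - xbar"] y(1)[OF yx] by (simp add: w_def dist_norm)
        moreover have "norm (n - w) \<le> norm e + norm (N (y - xbar) - w)"
          using norm_triangle_ineq[of e "N (y - xbar) - w"] by (simp add: e_def)
        ultimately have nw: "norm (n - w) \<le> \<eta> * (2 * r) + \<alpha> * r" by linarith
        have "v \<bullet> (n - w) \<le> norm v * norm (n - w)" by (rule norm_cauchy_schwarz)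
        also have "\<dots> \<le> L * (\<eta> * (2 * r) + \<alpha> * r)"
          using \<open>norm v \<le> L\<close> nw \<open>L > 0\<close> by (intro mult_mono) auto
        also have "\<dots> = (L * \<eta>) * (2 * r) + (L * \<alpha>) * r" by (simp add: algebra_simps)
        also have "\<dots> \<le> \<mu> * c / 16 * (2 * r) + \<mu> * c / 8 * r"
          using L\<alpha> r(1) unfolding L\<eta> by (intro add_mono mult_right_mono) auto
        finally have 1: "v \<bullet> n - v \<bullet> w \<le> \<mu> * c / 4 * r" by (simp add: inner_diff_right)
        have 2: "\<mu> * infdist y M \<le> v \<bullet> n" using near[OF ny] v by (simp add: n_def)
        have "c * r - \<alpha> * r \<le> infdist y M"
          using infdist_triangle[of x M y] False inf y(1)[OF yx] by (simp add: dist_commute)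
        then have "\<mu> * (c * r - \<alpha> * r) \<le> \<mu> * infdist y M" using \<open>\<mu> > 0\<close> by (intro mult_left_mono) auto
        moreover have "(\<mu> * \<alpha>) * r \<le> \<mu> * c / 4 * r" using \<mu>\<alpha> r(1) by (intro mult_right_mono) auto
        ultimately have "\<mu> * c / 2 * r \<le> v \<bullet> w" using 1 2 by (simp add: algebra_simps)
        then show "v \<in> {v. \<mu> * c / 2 * r \<le> w \<bullet> v}" by (simp add: inner_commute)
      qed
      then have "goldstein_subdifferential \<epsilon> f x \<subseteq> {v. \<mu> * c / 2 * r \<le> w \<bullet> v}"
        unfolding goldstein_subdifferential_def by (intro hull_minimal UN_least convex_halfspace_ge)
      then have "\<mu> * c / 2 * r \<le> w \<bullet> g" using g by blast
      also have "\<dots> \<le> norm w * norm g" by (rule norm_cauchy_schwarz)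
      also have "\<dots> \<le> r * norm g" using N1[of "x - xbar"] by (intro mult_right_mono) (auto simp: w_def r_def)
      finally have "\<mu> * c / 2 \<le> norm g" using r(1) by (simp add: mult.commute)
      \<comment> \<open>After cancelling \<open>r\<close> the bound on \<open>norm g\<close> is a
        constant; \<open>r < 1\<close> weakens it to a linear one.\<close>
      moreover have "r < 1" using near[OF nx] by (simp add: r_def dist_norm norm_minus_commute)
      then have "\<alpha> * r \<le> \<alpha> * 1" using \<open>\<alpha> > 0\<close> by (intro mult_left_mono) auto
      ultimately show ?thesis using \<alpha>(3) by (simp add: r_def[symmetric])
    qed
  qed
  then have "\<forall>\<^sub>F x in nhds xbar. \<alpha> * norm (x - xbar) \<le> goldstein_modulus f x"
    unfolding eventually_nhds_metric using \<open>\<rho> > 0\<close> by (intro exI[of _ "\<rho> / 2"]) auto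
  then show ?thesis using \<open>\<alpha> > 0\<close> by blast
qed

end
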